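(* Let $r\in\{0,1,2,\dots\}$ be fixed and let $n\to\infty$. Then the size $X_{n,r}$ of the random plane tree with $n$ nodes after deleting old leaves $r$ times satisfies $$\mathbb{E}X_{n,r}=(2-B_r(1/4))\,n-\frac{B_r'(1/4)}{8}+O(n^{-1}),$$ $$\mathbb{V}X_{n,r}=\Bigl(B_r(1/4)-B_r(1/4)^2+\frac{(2-B_r(1/4))B_r'(1/4)}{2}\Bigr)n+O(1),$$ where the $O$-constants may depend on $r$. Additionally, for fixed $r\ge1$, $X_{n,r}$ is asymptotically normally distributed, i.e. $$\frac{X_{n,r}-\mu n}{\sqrt{\sigma^2n}}\xrightarrow{\ d\ }\mathcal{N}(0,1),$$ where $\mu=2-B_r(1/4)$ and $\sigma^2=B_r(1/4)-B_r(1/4)^2+\frac{(2-B_r(1/4))B_r'(1/4)}{2}$.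
   Context: A plane tree is a finite rooted tree in which the children of every node are linearly ordered (from left to right); its size is its number of nodes. An old leaf is a leaf (node without children) that is the leftmost child of its parent; the root is never an old leaf. For a plane tree $\tau$, $\rho(\tau)$ is the plane tree obtained by simultaneously deleting all old leaves of $\tau$; the single-node tree is mapped to itself. $X_{n,r}$ is the size of $\rho^r(\tau)$, where $\tau$ is chosen uniformly at random among all plane trees of size $n$. The polynomials $B_r(z)$ are defined by $B_0(z)=1$ and $B_r(z)=1+zB_{r-1}(z)^2$ for $r\ge1$. *)

theory Defs
  imports "HOL-Probability.Probability" "HOL-Computational_Algebra.Polynomial"
begin

datatype plane_tree = Node "plane_tree list"

fun num_nodes :: "plane_tree \<Rightarrow> nat" where
  "num_nodes (Node ts) = 1 + sum_list (map num_nodes ts)"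

text \<open>
  The old leaf below a given node, if there is one, is its first child. In the second equation
  only that child is removed: leaf children further to the right are kept, since being leftmost
  is decided in the original tree.
\<close>
fun rho :: "plane_tree \<Rightarrow> plane_tree" where
  "rho (Node []) = Node []"
| "rho (Node (Node [] # ts)) = Node (map rho ts)"
| "rho (Node (Node (u # us) # ts)) = Node (rho (Node (u # us)) # map rho ts)"

definition plane_trees :: "nat \<Rightarrow> plane_tree set" where
  "plane_trees n = {t. num_nodes t = n}"

definition random_tree :: "nat \<Rightarrow> plane_tree pmf" where
  "random_tree n = pmf_of_set (plane_trees n)"

text \<open>
  \<open>pmf_of_set\<close> is meaningful only for finite nonempty sets; this holds for every positive size.
\<close>
lemma num_nodes_pos: "0 < num_nodes t"
  by (cases t) simp

lemma finite_plane_trees: "finite (plane_trees n)"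
proof (induction n rule: less_induct)
  case (less n)
  define S where "S = (\<Union>k<n. plane_trees k)"
  have fin: "finite S"
    unfolding S_def using less by blast
  have "plane_trees n \<subseteq> Node ` {ts. set ts \<subseteq> S \<and> length ts \<le> n}"
  proof
    fix t assume t: "t \<in> plane_trees n"
    obtain ts where ts: "t = Node ts" by (cases t)
    have n: "n = Suc (sum_list (map num_nodes ts))"
      using t by (simp add: plane_trees_def ts)
    have "num_nodes s < n" if "s \<in> set ts" for s
      using member_le_sum_list[of "num_nodes s" "map num_nodes ts"] that n by simp
    hence "set ts \<subseteq> S"
      by (auto simp: S_def plane_trees_def)
    moreover have "length ts \<le> sum_list (map num_nodes ts)"
    proof (induction ts)
      case (Cons a ts)
      thus ?case using num_nodes_pos[of a] by simp
    qed simp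
    ultimately show "t \<in> Node ` {ts. set ts \<subseteq> S \<and> length ts \<le> n}"
      using n by (auto simp: ts)
  qed
  thus ?case
    using finite_lists_length_le[OF fin] finite_subset by blast
qed

lemma plane_trees_nonempty:
  assumes "n \<ge> 1"
  shows "plane_trees n \<noteq> {}"
proof -
  have "num_nodes (Node (replicate (n - 1) (Node []))) = n"
    using assms by (simp add: sum_list_replicate)
  thus ?thesis unfolding plane_trees_def by blast
qed

definition reduced_size :: "nat \<Rightarrow> plane_tree \<Rightarrow> real" where
  "reduced_size r t = real (num_nodes ((rho ^^ r) t))"

fun B_poly :: "nat \<Rightarrow> real poly" where
  "B_poly 0 = 1"
| "B_poly (Suc r) = 1 + [:0, 1:] * (B_poly r)\<^sup>2"

definition mu :: "nat \<Rightarrow> real" where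
  "mu r = 2 - poly (B_poly r) (1/4)"

definition sigma_sq :: "nat \<Rightarrow> real" where
  "sigma_sq r = poly (B_poly r) (1/4) - (poly (B_poly r) (1/4))\<^sup>2
     + (2 - poly (B_poly r) (1/4)) * poly (pderiv (B_poly r)) (1/4) / 2"

end

theory Submission
  imports Defs "HOL-Computational_Algebra.Computational_Algebra" "HOL-Real_Asymp.Real_Asymp"
begin

text \<open>
  Cutting off the subtree of the last child of the root writes every plane tree other than the
  single node uniquely as \<open>graft s t\<close>, with sizes adding up. Under this correspondence with binary
  trees, deleting all old leaves amounts to collapsing all grafts of two single nodes
  (\<open>rho_graft\<close>). Hence the size after \<open>r\<close> rounds is additive under \<open>graft\<close>, apart from a correction
  by one on the grafts that have collapsed (\<open>rho_pow_graft_cases\<close>). The trees that collapse to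
  a single node within \<open>r\<close> rounds have the generating function \<open>a_r(z) = z B_r(z)\<close>, because
  \<open>a_0 = z\<close> and \<open>a_(r+1) = z + a_r\<^sup>2\<close>. The bivariate generating function \<open>F\<close>, with
  \<open>z\<close> marking the original and \<open>v\<close> the reduced size, thus satisfies the quadratic equation
  \<open>F = v z + F\<^sup>2 + (v - v\<^sup>2) (a_r - z)\<close> (\<open>size_gf_eq\<close>).

  For the moments, the generating functions of the first and second powers of the size satisfy
  analogous linear equations. Their solutions are polynomials times odd powers of
  \<open>sqrt (1 - 4 z)\<close>. Expanding the polynomials at \<open>1/4\<close> and comparing coefficients with those of
  \<open>sqrt (1 - 4 z)\<close>, which count all trees, gives \<open>expectation_asymp\<close> and \<open>variance_asymp\<close>.

  For the limit law, the quadratic equation gives \<open>(1 - 2 F)\<^sup>2 = D\<close> with a polynomial discriminant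
  \<open>D\<close> that equals \<open>1 - 4 z\<close> at \<open>v = 1\<close>. For \<open>v\<close> near 1 on the unit circle it has a root \<open>\<rho>\<close>
  near \<open>1/4\<close>, and the cofactor of \<open>1 - z / \<rho>\<close> in \<open>D\<close> is close to the constant 1 on a
  disc of radius 2 (\<open>disc_poly_root_exists\<close>, \<open>disc_poly_factor\<close>). So
  \<open>1 - 2 F\<close> is a small perturbation of \<open>sqrt (1 - z / \<rho>)\<close>, and the probability generating
  function of the size is \<open>(4 \<rho>)\<close> to the power \<open>-n\<close>, up to a factor tending to 1
  (\<open>sqrt_coeff_transfer\<close>, \<open>quasi_power_expansion\<close>). The second order expansion of \<open>\<rho>\<close> in \<open>v - 1\<close>
  (\<open>disc_poly_root_expand\<close>), taken at \<open>v = cis (t / sqrt (sigma_sq r * n))\<close>, then yields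
  convergence of the characteristic functions to the Gaussian one, and Levy's continuity
  theorem applies. The normalization is meaningful since \<open>sigma_sq r\<close> is positive for \<open>r \<ge> 1\<close>.
\<close>

abbreviation leaf :: plane_tree where "leaf \<equiv> Node []"

section \<open>Collapsing binary trees\<close>

text \<open>
  Cutting off the subtree of the last child of the root turns plane trees into binary trees
  whose external nodes are the nodes of the plane tree.
\<close>
fun graft :: "plane_tree \<Rightarrow> plane_tree \<Rightarrow> plane_tree" where
  "graft (Node ts) t = Node (ts @ [t])"

lemma num_nodes_graft [simp]: "num_nodes (graft s t) = num_nodes s + num_nodes t"
  by (cases s) simp

lemma graft_neq_leaf [simp]: "graft s t \<noteq> leaf"
  by (cases s) simp

lemma graft_inject [simp]: "graft s t = graft s' t' \<longleftrightarrow> s = s' \<and> t = t'"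
  by (cases s; cases s') auto

lemma leaf_or_graft: obtains "u = leaf" | s t where "u = graft s t"
proof (cases u)
  case (Node ts)
  show ?thesis
  proof (cases ts rule: rev_cases)
    case Nil
    thus ?thesis using Node that(1) by simp
  next
    case (snoc us t)
    hence "u = graft (Node us) t" using Node by simp
    thus ?thesis using that(2) by blast
  qed
qed

text \<open>
  The pair of a parent and its old leaf is \<open>graft leaf leaf\<close>. In the binary tree picture,
  \<open>rho\<close> therefore collapses exactly those internal nodes both of whose children are external.
\<close>
lemma rho_graft:
  "rho (graft s t) = (if s = leaf \<and> t = leaf then leaf else graft (rho s) (rho t))"
proof (cases s)
  case (Node ts)
  show ?thesis
  proof (cases ts)
    case Nil
    show ?thesis
    proof (cases t)
      case (Node us)
      thus ?thesis using Nil \<open>s = Node ts\<close> by (cases us) simp_all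
    qed
  next
    case (Cons x xs)
    show ?thesis
    proof (cases x)
      case (Node us)
      thus ?thesis using Cons \<open>s = Node ts\<close> by (cases us) simp_all
    qed
  qed
qed

lemma rho_pow_leaf [simp]: "(rho ^^ r) leaf = leaf"
  by (induction r) simp_all

text \<open>
  A collapsed node stays collapsed, and a node that survives the first \<open>r\<close> rounds is
  collapsed in the next one precisely when both sides have shrunk to a single node before it.
\<close>
lemma rho_pow_Suc_graft:
  "(rho ^^ Suc r) (graft s t) =
     (if (rho ^^ r) s = leaf \<and> (rho ^^ r) t = leaf then leaf
      else graft ((rho ^^ Suc r) s) ((rho ^^ Suc r) t))"
proof (induction r)
  case 0
  show ?case by (simp add: rho_graft)
next
  case (Suc r)
  have "(rho ^^ Suc (Suc r)) (graft s t) = rho ((rho ^^ Suc r) (graft s t))" by simp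
  also have "\<dots> = (if (rho ^^ r) s = leaf \<and> (rho ^^ r) t = leaf then leaf
      else rho (graft ((rho ^^ Suc r) s) ((rho ^^ Suc r) t)))"
    unfolding Suc.IH by simp
  also have "\<dots> = (if (rho ^^ Suc r) s = leaf \<and> (rho ^^ Suc r) t = leaf then leaf
      else graft ((rho ^^ Suc (Suc r)) s) ((rho ^^ Suc (Suc r)) t))"
    by (auto simp: rho_graft)
  finally show ?case .
qed

lemma rho_pow_Suc_graft_eq_leaf_iff:
  "(rho ^^ Suc r) (graft s t) = leaf \<longleftrightarrow> (rho ^^ r) s = leaf \<and> (rho ^^ r) t = leaf"
  unfolding rho_pow_Suc_graft by simp

text \<open>
  The size after \<open>r\<close> rounds is additive under \<open>graft\<close> except when the graft has collapsed.
  In that case both parts have size 1 as well, so additivity fails by exactly one node; this is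
  the correction term in all generating function equations below.
\<close>
lemma rho_pow_graft_cases:
  obtains (collapse) "(rho ^^ r) (graft s t) = leaf" "(rho ^^ r) s = leaf" "(rho ^^ r) t = leaf"
  | (persist) "(rho ^^ r) (graft s t) \<noteq> leaf"
      "num_nodes ((rho ^^ r) (graft s t)) = num_nodes ((rho ^^ r) s) + num_nodes ((rho ^^ r) t)"
proof (cases r)
  case 0
  thus ?thesis using that(2) by simp
next
  case (Suc q)
  show ?thesis
  proof (cases "(rho ^^ q) s = leaf \<and> (rho ^^ q) t = leaf")
    case True
    thus ?thesis using that(1) Suc by (simp add: rho_pow_Suc_graft del: funpow.simps) simp
  next
    case False
    hence "(rho ^^ r) (graft s t) = graft ((rho ^^ r) s) ((rho ^^ r) t)"
      unfolding Suc rho_pow_Suc_graft by (rule if_not_P)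
    thus ?thesis using that(2) by simp
  qed
qed

section \<open>Generating functions of weighted trees\<close>

lemma sum_plane_trees_graft:
  assumes "n \<noteq> 1"
  shows "(\<Sum>u\<in>plane_trees n. f u) =
           (\<Sum>k\<le>n. \<Sum>s\<in>plane_trees k. \<Sum>t\<in>plane_trees (n - k). f (graft s t))"
proof -
  define P where "P = (SIGMA k:{..n}. plane_trees k \<times> plane_trees (n - k))"
  have "plane_trees n = (\<lambda>(k, s, t). graft s t) ` P"
  proof (intro equalityI subsetI)
    fix u assume u: "u \<in> plane_trees n"
    show "u \<in> (\<lambda>(k, s, t). graft s t) ` P"
    proof (cases u rule: leaf_or_graft)
      case 1
      thus ?thesis using u assms by (simp add: plane_trees_def)
    next
      case (2 s t)
      hence "(num_nodes s, s, t) \<in> P"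
        using u by (auto simp: plane_trees_def P_def)
      thus ?thesis using 2 by (force intro!: image_eqI)
    qed
  qed (auto simp: P_def plane_trees_def)
  moreover have "inj_on (\<lambda>(k, s, t). graft s t) P"
    by (auto simp: inj_on_def P_def plane_trees_def)
  ultimately have "(\<Sum>u\<in>plane_trees n. f u) = (\<Sum>(k, s, t)\<in>P. f (graft s t))"
    by (simp add: sum.reindex case_prod_unfold)
  also have "\<dots> = (\<Sum>k\<le>n. \<Sum>(s, t)\<in>plane_trees k \<times> plane_trees (n - k). f (graft s t))"
    unfolding P_def by (subst sum.Sigma) (auto simp: finite_plane_trees case_prod_unfold)
  also have "\<dots> = (\<Sum>k\<le>n. \<Sum>s\<in>plane_trees k. \<Sum>t\<in>plane_trees (n - k). f (graft s t))"
    by (simp add: sum.cartesian_product)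
  finally show ?thesis .
qed

lemma plane_trees_0: "plane_trees 0 = {}"
  using num_nodes_pos by (force simp: plane_trees_def)

lemma plane_trees_1: "plane_trees 1 = {leaf}"
proof (intro equalityI subsetI)
  fix u assume u: "u \<in> plane_trees 1"
  show "u \<in> {leaf}"
  proof (cases u rule: leaf_or_graft)
    case (2 s t)
    thus ?thesis using u num_nodes_pos[of s] num_nodes_pos[of t] by (simp add: plane_trees_def)
  qed simp
qed (simp add: plane_trees_def)

definition tree_gf :: "(plane_tree \<Rightarrow> 'a :: comm_ring_1) \<Rightarrow> 'a fps" where
  "tree_gf w = Abs_fps (\<lambda>n. \<Sum>t\<in>plane_trees n. w t)"

text \<open>
  Weights are attached to a pair of trees rather than to their graft, so that a
  product weight gives a product of two generating functions.
\<close>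
definition pair_gf :: "(plane_tree \<Rightarrow> plane_tree \<Rightarrow> 'a :: comm_ring_1) \<Rightarrow> 'a fps" where
  "pair_gf w = Abs_fps (\<lambda>n. \<Sum>k\<le>n. \<Sum>s\<in>plane_trees k. \<Sum>t\<in>plane_trees (n - k). w s t)"

lemma tree_gf_graft:
  "tree_gf w = fps_const (w leaf) * fps_X + pair_gf (\<lambda>s t. w (graft s t))"
proof (rule fps_ext)
  fix n :: nat
  have *: "(\<Sum>k\<le>1. \<Sum>s\<in>plane_trees k. \<Sum>t\<in>plane_trees (1 - k). w (graft s t)) = 0"
    by (simp add: plane_trees_0)
  show "tree_gf w $ n = (fps_const (w leaf) * fps_X + pair_gf (\<lambda>s t. w (graft s t))) $ n"
  proof (cases "n = 1")
    case True
    thus ?thesis using * plane_trees_1 by (simp add: tree_gf_def pair_gf_def)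
  next
    case False
    thus ?thesis
      using sum_plane_trees_graft[OF False, of w] by (auto simp: tree_gf_def pair_gf_def fps_X_def)
  qed
qed

lemma pair_gf_mult: "pair_gf (\<lambda>s t. u s * w t) = tree_gf u * tree_gf w"
  by (rule fps_ext) (simp add: pair_gf_def tree_gf_def fps_mult_nth sum_product atLeast0AtMost)

lemma pair_gf_add: "pair_gf (\<lambda>s t. f s t + g s t) = pair_gf f + pair_gf g"
  by (rule fps_ext) (simp add: pair_gf_def sum.distrib)

lemma pair_gf_cmult: "pair_gf (\<lambda>s t. c * f s t) = fps_const c * pair_gf f"
  by (rule fps_ext) (simp add: pair_gf_def sum_distrib_left)

text \<open>
  The generating function of the trees that \<open>r\<close> rounds reduce to a single node: either the
  tree is a single node, or both of its parts are reduced to single nodes one round earlier. It is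
  kept as a polynomial over an arbitrary ring, since both real and complex coefficients are
  needed.
\<close>
fun short_poly :: "nat \<Rightarrow> 'a :: comm_ring_1 poly" where
  "short_poly 0 = [:0, 1:]"
| "short_poly (Suc r) = [:0, 1:] + (short_poly r)\<^sup>2"

definition short_gf :: "nat \<Rightarrow> 'a :: comm_ring_1 fps" where
  "short_gf r = fps_of_poly (short_poly r)"

lemma short_gf_0: "short_gf 0 = fps_X"
  by (simp only: short_gf_def short_poly.simps fps_of_poly_fps_X)

lemma short_gf_Suc: "short_gf (Suc r) = fps_X + (short_gf r)\<^sup>2"
  by (simp only: short_gf_def short_poly.simps fps_of_poly_fps_X fps_of_poly_add fps_of_poly_power)

lemma tree_gf_short: "tree_gf (\<lambda>t. of_bool ((rho ^^ r) t = leaf)) = short_gf r"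
proof (induction r)
  case 0
  have "pair_gf (\<lambda>s t. of_bool (graft s t = leaf)) = (0 :: 'a fps)"
    by (rule fps_ext) (simp add: pair_gf_def)
  thus ?case by (subst tree_gf_graft) (simp add: short_gf_0)
next
  case (Suc r)
  have "tree_gf (\<lambda>t. of_bool ((rho ^^ Suc r) t = leaf)) =
          (fps_X :: 'a fps) + pair_gf (\<lambda>s t. of_bool ((rho ^^ r) s = leaf) * of_bool ((rho ^^ r) t = leaf))"
    by (subst tree_gf_graft, subst rho_pow_Suc_graft_eq_leaf_iff)
       (simp add: of_bool_conj del: funpow.simps)
  thus ?case
    by (simp add: pair_gf_mult Suc.IH power2_eq_square short_gf_Suc)
qed

lemma pair_gf_short:
  "pair_gf (\<lambda>s t. of_bool ((rho ^^ r) (graft s t) = leaf)) = short_gf r - fps_X"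
  using tree_gf_short[of r] by (subst (asm) tree_gf_graft) (simp add: algebra_simps)

text \<open>
  On a collapsed graft the weight is \<open>v\<close>, whereas the product of the weights of the two parts is
  \<open>v\<^sup>2\<close>; this is the origin of the factor \<open>v - v\<^sup>2\<close>.
\<close>
lemma size_gf_eq:
  fixes v :: "'a :: comm_ring_1" and r :: nat
  defines "F \<equiv> tree_gf (\<lambda>t. v ^ num_nodes ((rho ^^ r) t))"
  shows "F = fps_const v * fps_X + F\<^sup>2 + fps_const (v - v\<^sup>2) * (short_gf r - fps_X)"
proof -
  let ?N = "\<lambda>t. num_nodes ((rho ^^ r) t)"
  have "v ^ ?N (graft s t) =
          v ^ ?N s * v ^ ?N t + (v - v\<^sup>2) * of_bool ((rho ^^ r) (graft s t) = leaf)" for s t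
    by (cases rule: rho_pow_graft_cases[of r s t]) (simp_all add: power_add power2_eq_square)
  hence "tree_gf (\<lambda>t. v ^ ?N t) = fps_const v * fps_X + pair_gf (\<lambda>s t. v ^ ?N s * v ^ ?N t
                + (v - v\<^sup>2) * of_bool ((rho ^^ r) (graft s t) = leaf))"
    by (subst tree_gf_graft) simp
  thus ?thesis
    unfolding pair_gf_add pair_gf_mult pair_gf_cmult pair_gf_short F_def power2_eq_square
    by (simp add: add.assoc)
qed

lemma count_gf_eq: "tree_gf (\<lambda>t. 1) = fps_X + (tree_gf (\<lambda>t. 1))\<^sup>2"
  using size_gf_eq[of 1 0] by (simp add: short_gf_0)

text \<open>
  The moments satisfy linear equations of their own. They follow from the same recursion as
  \<open>size_gf_eq\<close>, or from that equation by differentiating at \<open>v = 1\<close>.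
\<close>
lemma first_moment_gf_eq:
  fixes r :: nat
  defines "F\<^sub>0 \<equiv> tree_gf (\<lambda>t. 1)" and "F\<^sub>1 \<equiv> tree_gf (reduced_size r)"
  shows "F\<^sub>1 = fps_X + 2 * F\<^sub>0 * F\<^sub>1 - (short_gf r - fps_X)"
proof -
  let ?X = "reduced_size r"
  have "?X (graft s t) =
          ?X s * 1 + 1 * ?X t + (-1) * of_bool ((rho ^^ r) (graft s t) = leaf)" for s t
    by (cases rule: rho_pow_graft_cases[of r s t]) (simp_all add: reduced_size_def)
  hence "F\<^sub>1 = fps_X + pair_gf (\<lambda>s t. ?X s * 1 + 1 * ?X t
              + (-1) * of_bool ((rho ^^ r) (graft s t) = leaf))"
    unfolding F\<^sub>1_def by (subst tree_gf_graft) (simp add: reduced_size_def)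
  thus ?thesis
    unfolding pair_gf_add pair_gf_mult pair_gf_cmult pair_gf_short F\<^sub>0_def F\<^sub>1_def
    by (simp add: algebra_simps flip: fps_const_neg)
qed

text \<open>
  On a collapsed graft the square of the size is 1 and not \<open>(1 + 1)\<^sup>2 = 4\<close>.
\<close>
lemma second_moment_gf_eq:
  fixes r :: nat
  defines "F\<^sub>0 \<equiv> tree_gf (\<lambda>t. 1)" and "F\<^sub>1 \<equiv> tree_gf (reduced_size r)"
    and "F\<^sub>2 \<equiv> tree_gf (\<lambda>t. (reduced_size r t)\<^sup>2)"
  shows "F\<^sub>2 = fps_X + 2 * F\<^sub>0 * F\<^sub>2 + 2 * F\<^sub>1\<^sup>2 - 3 * (short_gf r - fps_X)"
proof -
  let ?X = "reduced_size r"
  have "(?X (graft s t))\<^sup>2 = (?X s)\<^sup>2 * 1 + 1 * (?X t)\<^sup>2 + 2 * (?X s * ?X t)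
          + (-3) * of_bool ((rho ^^ r) (graft s t) = leaf)" for s t
    by (cases rule: rho_pow_graft_cases[of r s t]) (simp_all add: reduced_size_def power2_eq_square algebra_simps)
  hence "F\<^sub>2 = fps_X + pair_gf (\<lambda>s t. (?X s)\<^sup>2 * 1 + 1 * (?X t)\<^sup>2 + 2 * (?X s * ?X t)
          + (-3) * of_bool ((rho ^^ r) (graft s t) = leaf))"
    unfolding F\<^sub>2_def by (subst tree_gf_graft) (simp add: reduced_size_def)
  thus ?thesis
    unfolding pair_gf_add pair_gf_mult pair_gf_cmult pair_gf_short F\<^sub>0_def F\<^sub>1_def F\<^sub>2_def
    by (simp add: algebra_simps power2_eq_square numeral_fps_const flip: fps_const_neg)
qed

lemma short_poly_real: "short_poly r = [:0, 1:] * B_poly r"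
  by (induction r) (simp_all add: power2_eq_square algebra_simps)

lemma poly_short_poly_complex:
  "poly (short_poly r) (complex_of_real x) = of_real (poly (short_poly r) x)"
  by (induction r) simp_all

lemma poly_pderiv_short_poly_complex:
  "poly (pderiv (short_poly r)) (complex_of_real x) = of_real (poly (pderiv (short_poly r)) x)"
  by (induction r)
     (simp_all add: pderiv_add pderiv_power pderiv_pCons pderiv_smult poly_short_poly_complex
        power2_eq_square pderiv_mult)

section \<open>Coefficients of powers of the square root singularity\<close>

definition sqrt_gf :: "real fps" where
  "sqrt_gf = 1 - 2 * tree_gf (\<lambda>t. 1)"

lemma sqrt_gf_square: "sqrt_gf\<^sup>2 = 1 - 4 * fps_X"
proof -
  have "sqrt_gf\<^sup>2 = 1 - 4 * (tree_gf (\<lambda>t. 1) - (tree_gf (\<lambda>t. 1))\<^sup>2)"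
    by (simp add: sqrt_gf_def power2_eq_square algebra_simps)
  also have "tree_gf (\<lambda>t. 1) - (tree_gf (\<lambda>t. 1))\<^sup>2 = (fps_X :: real fps)"
    using count_gf_eq[where 'a = real] by (simp add: algebra_simps)
  finally show ?thesis .
qed

lemma sqrt_gf_nth: "n \<ge> 1 \<Longrightarrow> sqrt_gf $ n = - 2 * real (card (plane_trees n))"
  by (simp add: sqrt_gf_def tree_gf_def numeral_fps_const fps_mult_left_const_nth)

lemma sqrt_gf_0 [simp]: "sqrt_gf $ 0 = 1"
  by (simp add: sqrt_gf_def tree_gf_def plane_trees_0 numeral_fps_const)

lemma sqrt_gf_nonzero [simp]: "sqrt_gf $ n \<noteq> 0"
proof (cases "n = 0")
  case False
  thus ?thesis
    using plane_trees_nonempty[of n] finite_plane_trees[of n] sqrt_gf_nth[of n] by simp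
qed simp

lemma sqrt_gf_deriv: "sqrt_gf * fps_deriv sqrt_gf = -2"
proof -
  have "fps_deriv (sqrt_gf\<^sup>2) = -4"
    unfolding sqrt_gf_square by (simp add: numeral_fps_const)
  hence "2 * (sqrt_gf * fps_deriv sqrt_gf) = 2 * (-2)"
    by (simp add: power2_eq_square algebra_simps)
  thus ?thesis
    by (simp only: mult_cancel_left) simp
qed

text \<open>
  Coefficients of \<open>f' * (1 - 4 * fps_X) = - 2 * f\<close>, where \<open>f\<close> is the square root \<open>sqrt_gf\<close>.
\<close>
lemma sqrt_gf_Suc: "(real n + 1) * sqrt_gf $ Suc n = (4 * real n - 2) * sqrt_gf $ n"
proof -
  have "fps_deriv sqrt_gf * (1 - 4 * fps_X) = sqrt_gf * (sqrt_gf * fps_deriv sqrt_gf)"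
    unfolding sqrt_gf_square[symmetric] by (simp add: power2_eq_square algebra_simps)
  hence "fps_deriv sqrt_gf - 4 * (fps_X * fps_deriv sqrt_gf) = - 2 * sqrt_gf"
    unfolding sqrt_gf_deriv by (simp add: algebra_simps)
  hence "(fps_deriv sqrt_gf - 4 * (fps_X * fps_deriv sqrt_gf)) $ n = (- 2 * sqrt_gf) $ n"
    by simp
  thus ?thesis
    by (cases n) (simp_all add: numeral_fps_const algebra_simps)
qed

lemma sqrt_gf_ratio_le_1: "\<bar>sqrt_gf $ n\<bar> \<le> \<bar>sqrt_gf $ Suc n\<bar>"
proof (cases "n = 0")
  case True
  thus ?thesis using sqrt_gf_Suc[of 0] by simp
next
  case False
  have "(real n + 1) * \<bar>sqrt_gf $ n\<bar> \<le> (4 * real n - 2) * \<bar>sqrt_gf $ n\<bar>"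
    using False by (intro mult_right_mono) auto
  also have "\<dots> = \<bar>(4 * real n - 2) * sqrt_gf $ n\<bar>"
    using False by (simp add: abs_mult)
  also have "\<dots> = (real n + 1) * \<bar>sqrt_gf $ Suc n\<bar>"
    unfolding sqrt_gf_Suc[symmetric] by (simp add: abs_mult)
  finally show ?thesis by simp
qed

text \<open>
  The recurrence factor \<open>(4 * n - 2) / (n + 1)\<close> is at least 1 in absolute value. Where coefficients
  of products are estimated below, this crude monotonicity is all that is used about Catalan
  numbers.
\<close>
lemma sqrt_gf_mono: "m \<le> n \<Longrightarrow> \<bar>sqrt_gf $ m\<bar> \<le> \<bar>sqrt_gf $ n\<bar>"
  by (rule lift_Suc_mono_le[of "\<lambda>n. \<bar>sqrt_gf $ n\<bar>", OF sqrt_gf_ratio_le_1])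

lemma inverse_sqrt_gf: "sqrt_gf * inverse sqrt_gf = 1"
  by (rule inverse_mult_eq_1') simp

lemma inverse_sqrt_gf_eq_deriv: "inverse sqrt_gf = fps_const (-1/2) * fps_deriv sqrt_gf"
proof -
  have "sqrt_gf * (fps_const (-1/2) * fps_deriv sqrt_gf) = fps_const (-1/2) * (sqrt_gf * fps_deriv sqrt_gf)"
    by (simp add: algebra_simps)
  also have "\<dots> = 1"
    unfolding sqrt_gf_deriv by (simp add: numeral_fps_const)
  finally show ?thesis
    by (metis fps_inverse_unique sqrt_gf_0)
qed

lemma inverse_sqrt_gf_nth: "inverse sqrt_gf $ n = (1 - 2 * real n) * sqrt_gf $ n"
  using sqrt_gf_Suc[of n] unfolding inverse_sqrt_gf_eq_deriv by (simp add: algebra_simps)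

text \<open>
  The derivative of \<open>(1 - 4 * z) powr (-1/2)\<close> is twice its cube.
\<close>
lemma inverse_sqrt_gf_cube_nth: "(inverse sqrt_gf ^ 3) $ n = (1 - 4 * (real n)\<^sup>2) * sqrt_gf $ n"
proof -
  have deriv: "fps_deriv sqrt_gf = fps_const (-2) * inverse sqrt_gf"
    unfolding inverse_sqrt_gf_eq_deriv by (simp flip: mult.assoc)
  have "fps_deriv (inverse sqrt_gf) = - fps_deriv sqrt_gf * (inverse sqrt_gf)\<^sup>2"
    by (rule fps_inverse_deriv) simp
  also have "\<dots> = 2 * inverse sqrt_gf ^ 3"
    unfolding deriv
    by (simp add: power3_eq_cube power2_eq_square numeral_fps_const mult.assoc
        flip: fps_const_neg)
  finally have "2 * (inverse sqrt_gf ^ 3) $ n = fps_deriv (inverse sqrt_gf) $ n"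
    by (simp add: numeral_fps_const)
  also have "\<dots> = (- 1 - 2 * real n) * ((real n + 1) * sqrt_gf $ Suc n)"
    by (simp add: inverse_sqrt_gf_nth algebra_simps)
  finally show ?thesis
    unfolding sqrt_gf_Suc by (simp add: algebra_simps power2_eq_square)
qed

text \<open>
  For \<open>n \<ge> 1\<close> the coefficient of \<open>sqrt_gf\<close> is \<open>-2\<close> times the number of trees, so
  up to this factor these quotients are the expected values over a random tree.
\<close>
definition rel_coeff :: "real fps \<Rightarrow> nat \<Rightarrow> real" where
  "rel_coeff f n = f $ n / sqrt_gf $ n"

lemma rel_coeff_add [simp]: "rel_coeff (f + g) n = rel_coeff f n + rel_coeff g n"
  by (simp add: rel_coeff_def add_divide_distrib)

lemma rel_coeff_cmult [simp]: "rel_coeff (fps_const c * f) n = c * rel_coeff f n"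
  by (simp add: rel_coeff_def)

lemma rel_coeff_sqrt [simp]: "rel_coeff sqrt_gf n = 1"
  by (simp add: rel_coeff_def)

lemma rel_coeff_inverse_sqrt [simp]: "rel_coeff (inverse sqrt_gf) n = 1 - 2 * real n"
  by (simp add: rel_coeff_def inverse_sqrt_gf_nth)

lemma rel_coeff_inverse_sqrt_cube [simp]:
  "rel_coeff (inverse sqrt_gf ^ 3) n = 1 - 4 * (real n)\<^sup>2"
  by (simp add: rel_coeff_def inverse_sqrt_gf_cube_nth)

lemma rel_coeff_X_mult_bigo:
  assumes f: "rel_coeff f \<in> O(g)" and g: "(\<lambda>n. g (n - 1)) \<in> O(g)"
  shows "rel_coeff (fps_X * f) \<in> O(g)"
proof -
  have "\<bar>rel_coeff (fps_X * f) n\<bar> \<le> \<bar>rel_coeff f (n - 1)\<bar>" if "n \<ge> 1" for n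
  proof -
    have "\<bar>f $ (n - 1)\<bar> / \<bar>sqrt_gf $ n\<bar> \<le> \<bar>f $ (n - 1)\<bar> / \<bar>sqrt_gf $ (n - 1)\<bar>"
      by (intro divide_left_mono sqrt_gf_mono) auto
    thus ?thesis using that by (simp add: rel_coeff_def)
  qed
  hence "rel_coeff (fps_X * f) \<in> O(\<lambda>n. rel_coeff f (n - 1))"
    by (intro landau_o.big_mono eventually_mono[OF eventually_ge_at_top[of 1]]) auto
  also have "(\<lambda>n. rel_coeff f (n - 1)) \<in> O(\<lambda>n. g (n - 1))"
    by (rule landau_o.big.compose[OF f]) real_asymp
  finally show ?thesis using g by (rule landau_o.big_trans)
qed

lemma rel_coeff_poly_mult_bigo:
  assumes f: "rel_coeff f \<in> O(g)" and g: "(\<lambda>n. g (n - 1)) \<in> O(g)"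
  shows "rel_coeff (fps_of_poly p * f) \<in> O(g)"
proof (induction p)
  case 0
  show ?case by (simp add: rel_coeff_def)
next
  case (pCons a p)
  have "rel_coeff (fps_of_poly (pCons a p) * f) =
          (\<lambda>n. a * rel_coeff f n + rel_coeff (fps_X * (fps_of_poly p * f)) n)"
    by (rule ext) (simp add: fps_of_poly_pCons algebra_simps flip: rel_coeff_add rel_coeff_cmult)
  also have "\<dots> \<in> O(g)"
    using f rel_coeff_X_mult_bigo[OF pCons.IH g] by (intro sum_in_bigo) auto
  finally show ?case .
qed

text \<open>
  Here \<open>sqrt_gf ^ 3 = sqrt_gf * (1 - 4 * fps_X)\<close>, and the recurrence makes the factor
  \<open>1 - 4 * fps_X\<close> cancel the coefficients up to a relative error of order \<open>1 / n\<close>.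
\<close>
lemma rel_coeff_sqrt_cube_bigo: "rel_coeff (sqrt_gf ^ 3) \<in> O(\<lambda>n. 1 / real n)"
proof -
  have "rel_coeff (sqrt_gf ^ 3) n = - 6 / (4 * real n - 6)" if "n \<ge> 2" for n
  proof -
    obtain m where m: "n = Suc m" "m \<ge> 1" using \<open>n \<ge> 2\<close> by (cases n) auto
    have "sqrt_gf ^ 3 = sqrt_gf * (1 - 4 * fps_X)"
      unfolding sqrt_gf_square[symmetric] by (simp add: power2_eq_square power3_eq_cube)
    also have "\<dots> = sqrt_gf - fps_const 4 * (fps_X * sqrt_gf)"
      by (simp add: algebra_simps numeral_fps_const)
    finally have "rel_coeff (sqrt_gf ^ 3) n = 1 - 4 * sqrt_gf $ m / sqrt_gf $ Suc m"
      using m by (simp add: rel_coeff_def diff_divide_distrib)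
    also have "sqrt_gf $ Suc m = (4 * real m - 2) * sqrt_gf $ m / (real m + 1)"
      unfolding sqrt_gf_Suc[symmetric] by simp
    also have "4 * sqrt_gf $ m / ((4 * real m - 2) * sqrt_gf $ m / (real m + 1)) =
                 4 * (real m + 1) / (4 * real m - 2)"
      by simp
    finally show ?thesis using m by (simp add: field_simps)
  qed
  hence "rel_coeff (sqrt_gf ^ 3) \<in> \<Theta>(\<lambda>n. - 6 / (4 * real n - 6))"
    by (intro bigthetaI_cong eventually_mono[OF eventually_ge_at_top[of 2]]) auto
  also have "(\<lambda>n. - 6 / (4 * real n - 6)) \<in> O(\<lambda>n. 1 / real n)"
    by real_asymp
  finally show ?thesis .
qed

lemma rel_coeff_poly_sqrt_cube_bigo:
  "rel_coeff (fps_of_poly p * sqrt_gf ^ 3) \<in> O(\<lambda>n. 1 / real n)"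
proof (rule rel_coeff_poly_mult_bigo[OF rel_coeff_sqrt_cube_bigo])
  show "(\<lambda>n. 1 / real (n - 1)) \<in> O(\<lambda>n. 1 / real n)" by real_asymp
qed

lemma rel_coeff_poly_sqrt_bigo: "rel_coeff (fps_of_poly p * sqrt_gf) \<in> O(\<lambda>n. 1)"
  by (rule rel_coeff_poly_mult_bigo) auto

lemma poly_expand_at:
  fixes p :: "'a :: idom poly"
  obtains q where "p = [:poly p c:] + [:-c, 1:] * q" "poly q c = poly (pderiv p) c"
proof
  show *: "p = [:poly p c:] + [:-c, 1:] * synthetic_div p c"
    using synthetic_div_correct'[of c p] by (simp add: algebra_simps)
  show "poly (synthetic_div p c) c = poly (pderiv p) c"
    by (subst (2) *) (simp only: pderiv_add pderiv_mult poly_add poly_mult, simp add: pderiv_pCons)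
qed

text \<open>
  Taylor expansion at the singularity: \<open>z - 1/4\<close> is \<open>-1/4\<close> times the square of \<open>sqrt_gf\<close>,
  so each further term in the expansion of a polynomial raises the exponent of \<open>sqrt_gf\<close> by two.
\<close>
lemma fps_of_poly_expand_quarter:
  fixes p :: "real poly"
  obtains q where "fps_of_poly p = fps_const (poly p (1/4)) + fps_of_poly q * sqrt_gf\<^sup>2"
    and "poly q (1/4) = - poly (pderiv p) (1/4) / 4"
proof -
  have u: "sqrt_gf\<^sup>2 = fps_of_poly (smult (-4) [:-(1/4), 1:])"
    unfolding sqrt_gf_square
    by (simp add: fps_of_poly_pCons numeral_fps_const flip: fps_const_neg)
  obtain q where q: "p = [:poly p (1/4):] + [:-(1/4), 1:] * q" "poly q (1/4) = poly (pderiv p) (1/4)"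
    by (rule poly_expand_at)
  have "p = [:poly p (1/4):] + smult (-1/4) q * smult (-4) [:-(1/4), 1:]"
    by (subst q(1)) (simp add: mult.commute)
  hence "fps_of_poly p = fps_of_poly ([:poly p (1/4):] + smult (-1/4) q * smult (-4) [:-(1/4), 1:])"
    by simp
  also have "\<dots> = fps_const (poly p (1/4)) + fps_of_poly (smult (-1/4) q) * sqrt_gf\<^sup>2"
    by (simp only: u fps_of_poly_add fps_of_poly_mult fps_of_poly_const)
  finally show ?thesis using q(2) by (intro that) auto
qed

text \<open>
  Two steps of the expansion give exponents \<open>-1\<close> and \<open>1\<close>, whose coefficients are known
  exactly, and a remainder with exponent 3.
\<close>
lemma rel_coeff_poly_inverse_sqrt:
  "(\<lambda>n. rel_coeff (fps_of_poly p * inverse sqrt_gf) n -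
      (poly p (1/4) * (1 - 2 * real n) - poly (pderiv p) (1/4) / 4)) \<in> O(\<lambda>n. 1 / real n)"
proof -
  obtain q where q: "fps_of_poly p = fps_const (poly p (1/4)) + fps_of_poly q * sqrt_gf\<^sup>2"
    "poly q (1/4) = - poly (pderiv p) (1/4) / 4"
    by (rule fps_of_poly_expand_quarter)
  obtain q' where q': "fps_of_poly q = fps_const (poly q (1/4)) + fps_of_poly q' * sqrt_gf\<^sup>2"
    by (rule fps_of_poly_expand_quarter)
  have "fps_of_poly p * inverse sqrt_gf = fps_const (poly p (1/4)) * inverse sqrt_gf
          + (fps_const (poly q (1/4)) * sqrt_gf + fps_of_poly q' * sqrt_gf ^ 3)
            * (sqrt_gf * inverse sqrt_gf)"
    unfolding q(1) q' by (simp add: algebra_simps power2_eq_square power3_eq_cube)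
  hence "rel_coeff (fps_of_poly p * inverse sqrt_gf) n -
           (poly p (1/4) * (1 - 2 * real n) - poly (pderiv p) (1/4) / 4)
         = rel_coeff (fps_of_poly q' * sqrt_gf ^ 3) n" for n
    unfolding inverse_sqrt_gf by (simp add: q(2))
  thus ?thesis using rel_coeff_poly_sqrt_cube_bigo[of q'] by simp
qed

lemma rel_coeff_poly_inverse_sqrt_cube:
  "(\<lambda>n. rel_coeff (fps_of_poly p * inverse sqrt_gf ^ 3) n -
      (poly p (1/4) * (1 - 4 * (real n)\<^sup>2) - poly (pderiv p) (1/4) / 4 * (1 - 2 * real n)))
    \<in> O(\<lambda>n. 1)"
proof -
  obtain q where q: "fps_of_poly p = fps_const (poly p (1/4)) + fps_of_poly q * sqrt_gf\<^sup>2"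
    "poly q (1/4) = - poly (pderiv p) (1/4) / 4"
    by (rule fps_of_poly_expand_quarter)
  obtain q' where q': "fps_of_poly q = fps_const (poly q (1/4)) + fps_of_poly q' * sqrt_gf\<^sup>2"
    by (rule fps_of_poly_expand_quarter)
  have "fps_of_poly p * inverse sqrt_gf ^ 3 = fps_const (poly p (1/4)) * inverse sqrt_gf ^ 3
          + fps_const (poly q (1/4)) * inverse sqrt_gf * (sqrt_gf * inverse sqrt_gf)\<^sup>2
          + fps_of_poly q' * sqrt_gf * (sqrt_gf * inverse sqrt_gf) ^ 3"
    unfolding q(1) q' by (simp add: algebra_simps power2_eq_square power3_eq_cube)
  hence "rel_coeff (fps_of_poly p * inverse sqrt_gf ^ 3) n -
      (poly p (1/4) * (1 - 4 * (real n)\<^sup>2) - poly (pderiv p) (1/4) / 4 * (1 - 2 * real n))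
         = rel_coeff (fps_of_poly q' * sqrt_gf) n" for n
    unfolding inverse_sqrt_gf by (simp add: q(2))
  thus ?thesis using rel_coeff_poly_sqrt_bigo[of q'] by simp
qed

lemma mult_sqrt_gf_eq_iff: "f * sqrt_gf = g \<longleftrightarrow> f = g * inverse sqrt_gf"
proof
  assume "f * sqrt_gf = g"
  hence "g * inverse sqrt_gf = f * (sqrt_gf * inverse sqrt_gf)" by (simp add: algebra_simps)
  thus "f = g * inverse sqrt_gf" by (simp add: inverse_sqrt_gf)
next
  assume "f = g * inverse sqrt_gf"
  hence "f * sqrt_gf = g * (sqrt_gf * inverse sqrt_gf)" by (simp add: algebra_simps)
  thus "f * sqrt_gf = g" by (simp add: inverse_sqrt_gf)
qed

section \<open>Mean and variance\<close>

text \<open>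
  Solving the linear equation divides by \<open>1 - 2 * tree_gf (\<lambda>t. 1)\<close>, which is \<open>sqrt_gf\<close>.
\<close>
lemma first_moment_gf:
  "tree_gf (reduced_size r) = fps_of_poly ([:0, 2:] - short_poly r) * inverse sqrt_gf"
proof -
  have "tree_gf (reduced_size r) * sqrt_gf = 2 * fps_X - short_gf r"
    using first_moment_gf_eq[of r] unfolding sqrt_gf_def by (simp add: algebra_simps)
  also have "\<dots> = fps_of_poly ([:0, 2:] - short_poly r)"
    unfolding short_gf_def fps_of_poly_diff
    by (simp add: fps_of_poly_pCons numeral_fps_const mult.commute)
  finally show ?thesis by (simp only: mult_sqrt_gf_eq_iff)
qed

lemma second_moment_gf:
  "tree_gf (\<lambda>t. (reduced_size r t)\<^sup>2) =
     2 * (fps_of_poly (([:0, 2:] - short_poly r)\<^sup>2) * inverse sqrt_gf ^ 3)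
     + fps_of_poly ([:0, 4:] - smult 3 (short_poly r)) * inverse sqrt_gf"
proof -
  let ?F1 = "tree_gf (reduced_size r)"
  have "tree_gf (\<lambda>t. (reduced_size r t)\<^sup>2) * sqrt_gf = 2 * ?F1\<^sup>2 + (4 * fps_X - 3 * short_gf r)"
    using second_moment_gf_eq[of r] unfolding sqrt_gf_def by (simp add: algebra_simps)
  also have "4 * fps_X - 3 * short_gf r = fps_of_poly ([:0, 4:] - smult 3 (short_poly r))"
    unfolding short_gf_def fps_of_poly_diff fps_of_poly_smult
    by (simp add: fps_of_poly_pCons numeral_fps_const mult.commute)
  finally have "tree_gf (\<lambda>t. (reduced_size r t)\<^sup>2) =
      (2 * ?F1\<^sup>2 + fps_of_poly ([:0, 4:] - smult 3 (short_poly r))) * inverse sqrt_gf"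
    by (simp only: mult_sqrt_gf_eq_iff)
  thus ?thesis
    unfolding first_moment_gf fps_of_poly_power
    by (simp add: algebra_simps power2_eq_square power3_eq_cube)
qed

lemma set_pmf_random_tree: "n \<ge> 1 \<Longrightarrow> set_pmf (random_tree n) = plane_trees n"
  unfolding random_tree_def
  by (rule set_pmf_of_set) (auto simp: plane_trees_nonempty finite_plane_trees)

lemma integrable_random_tree:
  fixes f :: "plane_tree \<Rightarrow> 'a :: {banach, second_countable_topology}"
  shows "n \<ge> 1 \<Longrightarrow> integrable (measure_pmf (random_tree n)) f"
  by (rule integrable_measure_pmf_finite) (simp add: set_pmf_random_tree finite_plane_trees)

lemma expectation_random_tree:
  fixes f :: "plane_tree \<Rightarrow> 'a :: {banach, second_countable_topology}"
  assumes "n \<ge> 1"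
  shows "measure_pmf.expectation (random_tree n) f =
           (\<Sum>t\<in>plane_trees n. f t) /\<^sub>R real (card (plane_trees n))"
  unfolding random_tree_def
  using plane_trees_nonempty[OF assms] finite_plane_trees[of n]
  by (subst integral_measure_pmf[of "plane_trees n"])
     (simp_all add: pmf_of_set scaleR_sum_right inverse_eq_divide)

lemma expectation_random_tree_real:
  fixes f :: "plane_tree \<Rightarrow> real"
  assumes "n \<ge> 1"
  shows "measure_pmf.expectation (random_tree n) f = - 2 * rel_coeff (tree_gf f) n"
  using assms by (simp add: expectation_random_tree rel_coeff_def tree_gf_def sqrt_gf_nth inverse_eq_divide)

lemma expectation_asymp:
  "(\<lambda>n. measure_pmf.expectation (random_tree n) (reduced_size r)
       - (mu r * real n - poly (pderiv (B_poly r)) (1/4) / 8)) \<in> O(\<lambda>n. 1 / real n)"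
proof -
  define p :: "real poly" where "p = [:0, 2:] - short_poly r"
  have p: "poly p (1/4) = mu r / 4"
      "poly (pderiv p) (1/4) = mu r - poly (pderiv (B_poly r)) (1/4) / 4"
    by (simp_all add: p_def mu_def short_poly_real pderiv_diff pderiv_mult pderiv_pCons field_simps)
  have bound: "(\<lambda>n. -2 * (rel_coeff (fps_of_poly p * inverse sqrt_gf) n -
      (poly p (1/4) * (1 - 2 * real n) - poly (pderiv p) (1/4) / 4))) \<in> O(\<lambda>n. 1 / real n)"
    using rel_coeff_poly_inverse_sqrt[of p] by (simp only: landau_o.big.cmult_in_iff)
  have eq: "-2 * (rel_coeff (fps_of_poly p * inverse sqrt_gf) n -
      (poly p (1/4) * (1 - 2 * real n) - poly (pderiv p) (1/4) / 4)) =
      measure_pmf.expectation (random_tree n) (reduced_size r)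
       - (mu r * real n - poly (pderiv (B_poly r)) (1/4) / 8)" if "n \<ge> 1" for n
    unfolding expectation_random_tree_real[OF that] first_moment_gf p_def[symmetric] p
    by (simp add: field_simps)
  have "eventually (\<lambda>n. measure_pmf.expectation (random_tree n) (reduced_size r)
       - (mu r * real n - poly (pderiv (B_poly r)) (1/4) / 8) =
      -2 * (rel_coeff (fps_of_poly p * inverse sqrt_gf) n -
      (poly p (1/4) * (1 - 2 * real n) - poly (pderiv p) (1/4) / 4))) at_top"
    by (rule eventually_mono[OF eventually_ge_at_top[of 1]]) (rule eq[symmetric])
  from landau_o.big.in_cong[OF this] bound show ?thesis by blast
qed

text \<open>
  The square of the mean is needed up to an error \<open>O(1)\<close>. Since the mean is linear in \<open>n\<close>, this
  is where its error term \<open>O(1 / n)\<close> is used.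
\<close>
lemma variance_asymp:
  "(\<lambda>n. measure_pmf.variance (random_tree n) (reduced_size r) - sigma_sq r * real n) \<in> O(\<lambda>n. 1)"
proof -
  define p w :: "real poly" where "p = [:0, 2:] - short_poly r" and "w = [:0, 4:] - smult 3 (short_poly r)"
  define b d where "b = poly (B_poly r) (1/4)" and "d = poly (pderiv (B_poly r)) (1/4)"
  define E1 E2 V where "E1 n = measure_pmf.expectation (random_tree n) (reduced_size r)"
    and "E2 n = measure_pmf.expectation (random_tree n) (\<lambda>t. (reduced_size r t)\<^sup>2)"
    and "V n = measure_pmf.variance (random_tree n) (reduced_size r)" for n
  define e1 where "e1 n = E1 n - (mu r * real n - d / 8)" for n
  define e2 where "e2 n = rel_coeff (fps_of_poly (p\<^sup>2) * inverse sqrt_gf ^ 3) n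
     - (poly (p\<^sup>2) (1/4) * (1 - 4 * (real n)\<^sup>2) - poly (pderiv (p\<^sup>2)) (1/4) / 4 * (1 - 2 * real n))" for n
  define e3 where "e3 n = rel_coeff (fps_of_poly w * inverse sqrt_gf) n
     - (poly w (1/4) * (1 - 2 * real n) - poly (pderiv w) (1/4) / 4)" for n
  have p: "poly p (1/4) = (2 - b) / 4" "poly (pderiv p) (1/4) = 2 - b - d / 4"
    and w: "poly w (1/4) = 1 - 3 * b / 4"
    by (simp_all add: p_def w_def b_def d_def short_poly_real pderiv_diff pderiv_mult pderiv_pCons field_simps)
  have e1: "e1 \<in> O(\<lambda>n. 1 / real n)"
    unfolding e1_def E1_def d_def by (rule expectation_asymp)
  have e2: "e2 \<in> O(\<lambda>n. 1)"
    unfolding e2_def by (rule rel_coeff_poly_inverse_sqrt_cube)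
  have "e3 \<in> O(\<lambda>n. 1 / real n)"
    unfolding e3_def by (rule rel_coeff_poly_inverse_sqrt)
  also have "(\<lambda>n. 1 / real n) \<in> O(\<lambda>n. 1)" by real_asymp
  finally have e3: "e3 \<in> O(\<lambda>n. 1)" .
  have V: "V n = E2 n - (E1 n)\<^sup>2" if "n \<ge> 1" for n
    unfolding V_def E2_def E1_def
    by (rule measure_pmf.variance_eq) (rule integrable_random_tree[OF that])+
  have E2: "E2 n = -2 * (2 * (e2 n + (poly (p\<^sup>2) (1/4) * (1 - 4 * (real n)\<^sup>2)
        - poly (pderiv (p\<^sup>2)) (1/4) / 4 * (1 - 2 * real n)))
      + (e3 n + (poly w (1/4) * (1 - 2 * real n) - poly (pderiv w) (1/4) / 4)))"
    if "n \<ge> 1" for n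
    unfolding E2_def expectation_random_tree_real[OF that] second_moment_gf
    by (simp add: e2_def e3_def p_def w_def numeral_fps_const)
  \<comment> \<open>The constant that remains after the terms of order \<open>n\<^sup>2\<close> cancel and those of order \<open>n\<close>
      add up to \<open>sigma_sq r\<close>.\<close>
  define K where "K = - 4 * poly (p\<^sup>2) (1/4) + poly (pderiv (p\<^sup>2)) (1/4) - 2 * poly w (1/4)
      + poly (pderiv w) (1/4) / 2 - (d / 8)\<^sup>2"
  have "V n - sigma_sq r * real n =
          - 4 * e2 n - 2 * e3 n + K - 2 * mu r * (real n * e1 n) + d / 4 * e1 n - (e1 n)\<^sup>2"
    if "n \<ge> 1" for n
  proof -
    have *: "E1 n = e1 n + mu r * real n - d / 8" by (simp add: e1_def)
    show ?thesis
      unfolding V[OF that] E2[OF that] * K_def sigma_sq_def mu_def b_def[symmetric] d_def[symmetric]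
      by (simp add: p w pderiv_power power2_eq_square pderiv_mult algebra_simps)
        (simp add: field_simps)
  qed
  moreover have "(\<lambda>n. - 4 * e2 n - 2 * e3 n + K - 2 * mu r * (real n * e1 n) + d / 4 * e1 n - (e1 n)\<^sup>2)
      \<in> O(\<lambda>n. 1)"
  proof -
    have "(\<lambda>n. real n * e1 n) \<in> O(\<lambda>n. real n * (1 / real n))"
      by (intro landau_o.big.mult e1) simp
    also have "(\<lambda>n. real n * (1 / real n)) \<in> O(\<lambda>n. 1)" by real_asymp
    finally have ne1: "(\<lambda>n. real n * e1 n) \<in> O(\<lambda>n. 1)" .
    have e1': "e1 \<in> O(\<lambda>n. 1)"
      using e1 by (rule landau_o.big_trans) real_asymp
    have "(\<lambda>n. (e1 n)\<^sup>2) \<in> O(\<lambda>n. 1)"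
      using landau_o.big_power[OF e1', of 2] by simp
    thus ?thesis
      using e2 e3 ne1 e1' by (intro sum_in_bigo) auto
  qed
  ultimately have "(\<lambda>n. V n - sigma_sq r * real n) \<in> O(\<lambda>n. 1)"
    by (subst landau_o.big.in_cong[OF eventually_mono[OF eventually_ge_at_top[of 1]]])
  thus ?thesis unfolding V_def .
qed

section \<open>Positivity of the limit variance\<close>

text \<open>
  This is the positivity of \<open>sigma_sq\<close> with denominators cleared. Write \<open>b\<close> and \<open>d\<close> for the values
  of \<open>B_r\<close> and its derivative at \<open>1/4\<close>. The weak inequality \<open>(2 - b) * d \<ge> 2 * b * (b - 1)\<close> is an
  equality for \<open>r = 0\<close>. In the next step it gives \<open>(2 - b) * d' \<ge> b\<^sup>2\<close> for the new derivative
  \<open>d' = b\<^sup>2 + b * d / 2\<close>, and the new strict inequality then reduces to \<open>4 + b\<^sup>2 < 4 + 2 * b\<close>,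
  that is, to \<open>b < 2\<close>.
\<close>
lemma B_poly_quarter_deriv_gt:
  defines "b \<equiv> \<lambda>r. poly (B_poly r) (1/4)" and "d \<equiv> \<lambda>r. poly (pderiv (B_poly r)) (1/4)"
  shows "r \<ge> 1 \<Longrightarrow> 2 * b r * (b r - 1) < (2 - b r) * d r"
proof -
  have rec: "b (Suc r) = 1 + (b r)\<^sup>2 / 4" "d (Suc r) = (b r)\<^sup>2 + b r * d r / 2" for r
    by (simp_all add: b_def d_def pderiv_add pderiv_mult pderiv_power pderiv_pCons power2_eq_square)
  have step: "b (Suc r) < 2 \<and> 2 * b (Suc r) * (b (Suc r) - 1) < (2 - b (Suc r)) * d (Suc r)"
    if "1 \<le> b r" "b r < 2" "2 * b r * (b r - 1) \<le> (2 - b r) * d r" for r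
  proof
    show "b (Suc r) < 2"
      using power_strict_mono[of "b r" 2 2] that by (simp add: rec)
    have "(b r)\<^sup>2 * (4 + b r * b r) < (b r)\<^sup>2 * (4 + b r * 2)"
      using that by (intro mult_strict_left_mono add_strict_left_mono) auto
    hence "2 * b (Suc r) * (b (Suc r) - 1) < (2 + b r) / 4 * (b r)\<^sup>2"
      by (simp add: rec power2_eq_square algebra_simps)
    also have "(b r)\<^sup>2 \<le> (2 - b r) * d (Suc r)"
      using mult_left_mono[OF that(3), of "b r / 2"] that(1)
      by (simp add: rec power2_eq_square algebra_simps diff_divide_distrib)
    hence "(2 + b r) / 4 * (b r)\<^sup>2 \<le> (2 + b r) / 4 * ((2 - b r) * d (Suc r))"
      using that(1) by (intro mult_left_mono) auto
    also have "\<dots> = (2 - b (Suc r)) * d (Suc r)"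
      by (simp add: rec(1) power2_eq_square algebra_simps add_divide_distrib)
    finally show "2 * b (Suc r) * (b (Suc r) - 1) < (2 - b (Suc r)) * d (Suc r)" .
  qed
  have all: "1 \<le> b r \<and> b r < 2 \<and> 2 * b r * (b r - 1) \<le> (2 - b r) * d r" for r
  proof (induction r)
    case 0
    show ?case by (simp add: b_def d_def)
  next
    case (Suc r)
    thus ?case using step[of r] by (simp add: rec(1) less_imp_le)
  qed
  show "2 * b r * (b r - 1) < (2 - b r) * d r" if "r \<ge> 1"
    using step[of "r - 1"] all[of "r - 1"] that by simp
qed

lemma sigma_sq_pos: "r \<ge> 1 \<Longrightarrow> sigma_sq r > 0"
  using B_poly_quarter_deriv_gt[of r] by (simp add: sigma_sq_def power2_eq_square algebra_simps diff_divide_distrib)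

lemma poly_short_poly_0: "poly (short_poly r) 0 = 0"
  by (induction r) simp_all

section \<open>The moving square root singularity\<close>

text \<open>
  The discriminant of the quadratic equation for the size generating function, written as a
  perturbation of \<open>1 - 4 * z\<close> that vanishes at \<open>v = 1\<close>.
\<close>
definition disc_poly :: "nat \<Rightarrow> complex \<Rightarrow> complex poly" where
  "disc_poly r v = [:1, -4:] + smult (4 * (v - 1)) (smult v (short_poly r) - smult (v + 1) [:0, 1:])"

lemma size_gf_disc:
  "(1 - 2 * tree_gf (\<lambda>t. v ^ num_nodes ((rho ^^ r) t)))\<^sup>2 = fps_of_poly (disc_poly r v)"
proof -
  define F where "F = tree_gf (\<lambda>t. v ^ num_nodes ((rho ^^ r) t))"
  have "F - F\<^sup>2 = fps_const v * fps_X + fps_const (v - v\<^sup>2) * (short_gf r - fps_X)"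
    using size_gf_eq[of v r] unfolding F_def by (simp add: algebra_simps)
  moreover have "(1 - 2 * F)\<^sup>2 = 1 - 4 * (F - F\<^sup>2)"
    by (simp add: power2_eq_square algebra_simps)
  ultimately have "(1 - 2 * F)\<^sup>2 =
      1 - 4 * (fps_const v * fps_X + fps_const (v - v\<^sup>2) * (short_gf r - fps_X))"
    by simp
  also have "\<dots> = fps_of_poly (disc_poly r v)"
    by (simp add: fps_eq_iff disc_poly_def short_gf_def numeral_fps_const fps_X_def coeff_pCons
          power2_eq_square algebra_simps fps_one_def split: nat.splits)
  finally show ?thesis unfolding F_def .
qed

text \<open>
  The roots are the fixed points of \<open>z \<mapsto> 1/4 + (v - 1) * g z\<close> for a function \<open>g\<close> that is
  bounded near \<open>1/4\<close>. For \<open>v\<close> close to 1 this maps a small disc into itself, and Brouwer's theorem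
  applies.
\<close>
lemma disc_poly_root_exists:
  obtains M where "M > 0"
    "\<And>v. norm v = 1 \<Longrightarrow> M * norm (v - 1) \<le> 1/4 \<Longrightarrow>
       \<exists>\<rho>. norm (\<rho> - 1/4) \<le> M * norm (v - 1) \<and> poly (disc_poly r v) \<rho> = 0"
proof -
  obtain m where m: "m > 0" "\<And>z :: complex. norm z \<le> 1/2 \<Longrightarrow> norm (poly (short_poly r) z) \<le> m"
    using poly_bound_exists[of "1/2" "short_poly r"] by blast
  show ?thesis
  proof (rule that[of "m + 1"])
    fix v :: complex
    assume v: "norm v = 1" "(m + 1) * norm (v - 1) \<le> 1/4"
    define g where "g z = v * poly (short_poly r) z - (v + 1) * z" for z
    define f where "f z = 1/4 + (v - 1) * g z" for z
    define S where "S = cball (1/4 :: complex) ((m + 1) * norm (v - 1))"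
    have "f \<in> S \<rightarrow> S"
    proof
      fix z assume "z \<in> S"
      hence "norm (z - 1/4) \<le> 1/4"
        using v by (simp add: S_def dist_norm norm_minus_commute)
      hence z: "norm z \<le> 1/2"
        using norm_triangle_ineq[of "z - 1/4" "1/4"] by (simp add: norm_divide)
      have "norm (g z) \<le> norm v * norm (poly (short_poly r) z) + norm (v + 1) * norm z"
        unfolding g_def by (rule order.trans[OF norm_triangle_ineq4]) (simp add: norm_mult)
      also have "\<dots> \<le> 1 * m + 2 * (1/2)"
        using v m(2)[OF z] z norm_triangle_ineq[of v 1] by (intro add_mono mult_mono) auto
      finally have "norm (v - 1) * norm (g z) \<le> norm (v - 1) * (m + 1)"
        by (intro mult_left_mono) auto
      thus "f z \<in> S"
        by (simp add: f_def S_def dist_norm norm_mult mult.commute)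
    qed
    moreover have "continuous_on S f"
      unfolding f_def g_def by (intro continuous_intros)
    moreover have "0 \<le> (m + 1) * norm (v - 1)"
      using m(1) by simp
    hence "S \<noteq> {}" "compact S" "convex S"
      by (simp_all add: S_def)
    ultimately obtain \<rho> where \<rho>: "\<rho> \<in> S" "f \<rho> = \<rho>"
      using brouwer by metis
    have "poly (disc_poly r v) \<rho> = 4 * (f \<rho> - \<rho>)"
      by (simp add: disc_poly_def f_def g_def algebra_simps)
    thus "\<exists>\<rho>. norm (\<rho> - 1/4) \<le> (m + 1) * norm (v - 1) \<and> poly (disc_poly r v) \<rho> = 0"
      using \<rho> by (intro exI[of _ \<rho>]) (auto simp: S_def dist_norm norm_minus_commute)
  qed (use m in simp)
qed

text \<open>
  Dividing a fixed polynomial by \<open>z - c\<close> gives quotients with uniformly bounded coefficients. This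
  is used for the difference quotient of \<open>short_poly r\<close> at a root that moves with \<open>v\<close>.
\<close>
lemma synthetic_div_coeff_bound:
  fixes p :: "complex poly"
  assumes "R \<ge> 0"
  shows "\<exists>M. \<forall>c m. norm c \<le> 1 \<longrightarrow> (\<Sum>k\<le>m. norm (coeff (synthetic_div p c) k) * R ^ k) \<le> M"
proof (induction p)
  case 0
  show ?case by (intro exI[of _ 0]) simp
next
  case (pCons a p)
  then obtain M where M: "\<And>c m. norm c \<le> 1 \<Longrightarrow> (\<Sum>k\<le>m. norm (coeff (synthetic_div p c) k) * R ^ k) \<le> M"
    by blast
  obtain m' where m': "\<And>z. norm z \<le> 1 \<Longrightarrow> norm (poly p z) \<le> m'"
    using poly_bound_exists[of 1 p] by blast
  have "(\<Sum>k\<le>m. norm (coeff (synthetic_div (pCons a p) c) k) * R ^ k) \<le> m' + R * M"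
    if c: "norm c \<le> 1" for c m
  proof -
    have "(\<Sum>k\<le>m. norm (coeff (synthetic_div (pCons a p) c) k) * R ^ k)
            \<le> (\<Sum>k\<le>Suc m. norm (coeff (synthetic_div (pCons a p) c) k) * R ^ k)"
      using assms by simp
    also have "\<dots> = norm (poly p c) + R * (\<Sum>k\<le>m. norm (coeff (synthetic_div p c) k) * R ^ k)"
      by (subst sum.atMost_Suc_shift) (simp add: sum_distrib_left algebra_simps)
    also have "\<dots> \<le> m' + R * M"
      using M[OF c] m'[OF c] assms by (intro add_mono mult_left_mono) auto
    finally show ?thesis .
  qed
  thus ?case by blast
qed

text \<open>
  Subtracting the value 0 at the root from the discriminant and dividing by \<open>z - \<rho>\<close> leaves
  \<open>-4\<close> plus a multiple of \<open>v - 1\<close>. Hence the cofactor of the singular factor \<open>1 - z / \<rho>\<close> is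
  a constant up to coefficients of order \<open>v - 1\<close>. The weights \<open>2 ^ k\<close> measure it on a disc of
  radius 2, far beyond the singularity.
\<close>
lemma disc_poly_factor:
  obtains C where "C > 0"
    "\<And>v \<rho>. norm v = 1 \<Longrightarrow> \<rho> \<noteq> 0 \<Longrightarrow> norm \<rho> \<le> 1/2 \<Longrightarrow> poly (disc_poly r v) \<rho> = 0 \<Longrightarrow>
       \<exists>Q. disc_poly r v = [:1, -1/\<rho>:] * Q \<and>
           (\<forall>m. (\<Sum>k=1..m. norm (coeff Q k) * 2 ^ k) \<le> C * norm (v - 1))"
proof -
  obtain M where M: "\<And>c m. norm c \<le> 1 \<Longrightarrow>
      (\<Sum>k\<le>m. norm (coeff (synthetic_div (short_poly r) (c :: complex)) k) * 2 ^ k) \<le> M"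
    using synthetic_div_coeff_bound[of 2 "short_poly r"] by auto
  have "M \<ge> 0"
    using order.trans[OF _ M[of 0 0]] by simp
  show ?thesis
  proof (rule that[of "2 * M + 1"])
    fix v \<rho> :: complex
    assume v: "norm v = 1" and \<rho>: "\<rho> \<noteq> 0" "norm \<rho> \<le> 1/2" and root: "poly (disc_poly r v) \<rho> = 0"
    define K where "K = synthetic_div (short_poly r) \<rho>"
    define L where "L = [:-4 - 4 * (v - 1) * (v + 1):] + smult (4 * (v - 1) * v) K"
    have K: "poly (short_poly r) x = (x - \<rho>) * poly K x + poly (short_poly r) \<rho>" for x
      using arg_cong[OF synthetic_div_correct'[of \<rho> "short_poly r"], of "\<lambda>p. poly p x"]
      by (simp add: K_def algebra_simps)
    have root': "1 - 4 * \<rho> + 4 * (v - 1) * (v * poly (short_poly r) \<rho> - (v + 1) * \<rho>) = 0"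
      using root by (simp add: disc_poly_def algebra_simps)
    have "poly (disc_poly r v) x = (x - \<rho>) * poly L x" for x
    proof -
      have "poly (disc_poly r v) x = (x - \<rho>) * poly L x
              + (1 - 4 * \<rho> + 4 * (v - 1) * (v * poly (short_poly r) \<rho> - (v + 1) * \<rho>))"
        by (simp add: disc_poly_def L_def K[of x] algebra_simps)
      thus ?thesis unfolding root' by simp
    qed
    hence "poly (disc_poly r v) = poly ([:1, -1/\<rho>:] * smult (-\<rho>) L)"
      using \<rho>(1) by (intro ext) (simp add: field_simps)
    hence factor: "disc_poly r v = [:1, -1/\<rho>:] * smult (-\<rho>) L"
      by (simp only: poly_eq_poly_eq_iff)
    have "(\<Sum>k=1..m. norm (coeff (smult (-\<rho>) L) k) * 2 ^ k) \<le> (2 * M + 1) * norm (v - 1)" for m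
    proof -
      have "(\<Sum>k=1..m. norm (coeff (smult (-\<rho>) L) k) * 2 ^ k)
              = norm \<rho> * 4 * norm (v - 1) * (\<Sum>k=1..m. norm (coeff K k) * 2 ^ k)"
        unfolding sum_distrib_left
      proof (rule sum.cong[OF refl])
        fix k assume "k \<in> {1..m}"
        hence "coeff L k = 4 * (v - 1) * v * coeff K k"
          by (cases k) (simp_all add: L_def)
        hence "norm (coeff L k) = 4 * norm (v - 1) * norm (coeff K k)"
          using v by (simp only: norm_mult) simp
        thus "norm (coeff (smult (-\<rho>) L) k) * 2 ^ k =
                norm \<rho> * 4 * norm (v - 1) * (norm (coeff K k) * 2 ^ k)"
          by (simp add: norm_mult)
      qed
      also have "\<dots> \<le> (1/2) * 4 * norm (v - 1) * (\<Sum>k\<le>m. norm (coeff K k) * 2 ^ k)"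
        using \<rho>(2) by (intro mult_mono sum_mono2 mult_nonneg_nonneg sum_nonneg) auto
      also have "\<dots> \<le> (1/2) * 4 * norm (v - 1) * M"
        unfolding K_def using \<rho>(2) by (intro mult_left_mono M) auto
      also have "\<dots> \<le> (2 * M + 1) * norm (v - 1)"
        by (simp add: algebra_simps)
      finally show ?thesis .
    qed
    thus "\<exists>Q. disc_poly r v = [:1, -1/\<rho>:] * Q \<and>
           (\<forall>m. (\<Sum>k=1..m. norm (coeff Q k) * 2 ^ k) \<le> (2 * M + 1) * norm (v - 1))"
      using factor by blast
  qed (use \<open>M \<ge> 0\<close> in simp)
qed

text \<open>
  Taking a square root does not increase the total weight of the nonconstant part: comparing
  coefficients in \<open>H\<^sup>2\<close>, the tail \<open>A\<close> of \<open>H\<close> satisfies \<open>2 * A \<le> \<eta> + A\<^sup>2\<close>, where the \<open>A\<close> on the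
  right involves fewer coefficients. If that one is at most \<open>\<eta> \<le> 1\<close>, so is the one on the left.
\<close>
lemma fps_sqrt_tail_bound:
  fixes H :: "complex fps"
  assumes H0: "H $ 0 = 1" and R: "R \<ge> 0" and \<eta>: "\<eta> \<le> 1"
    and tail: "\<And>m. (\<Sum>k=1..m. norm ((H\<^sup>2) $ k) * R ^ k) \<le> \<eta>"
  shows "(\<Sum>k=1..m. norm (H $ k) * R ^ k) \<le> \<eta>"
proof (induction m)
  case 0
  show ?case using tail[of 0] by simp
next
  case (Suc m)
  define a where "a k = norm (H $ k) * R ^ k" for k
  have a_nonneg: "a k \<ge> 0" for k
    using R by (simp add: a_def)
  have "\<eta> \<ge> 0" using tail[of 0] by simp
  have coeff: "2 * a k \<le> norm ((H\<^sup>2) $ k) * R ^ k + (\<Sum>i=1..<k. a i * a (k - i))" if "k \<ge> 1" for k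
  proof -
    have "(H\<^sup>2) $ k = (\<Sum>i=0..k. H $ i * H $ (k - i))"
      by (simp add: power2_eq_square fps_mult_nth)
    also have "{0..k} = insert 0 (insert k {1..<k})"
      using that by auto
    also have "(\<Sum>i\<in>\<dots>. H $ i * H $ (k - i)) = 2 * H $ k + (\<Sum>i=1..<k. H $ i * H $ (k - i))"
      using that by (simp add: H0)
    finally have "2 * H $ k = (H\<^sup>2) $ k - (\<Sum>i=1..<k. H $ i * H $ (k - i))"
      by simp
    hence "norm (2 * H $ k) \<le> norm ((H\<^sup>2) $ k) + (\<Sum>i=1..<k. norm (H $ i * H $ (k - i)))"
      by (simp only:) (rule order.trans[OF norm_triangle_ineq4 add_left_mono[OF norm_sum]])
    hence "norm (2 * H $ k) * R ^ k \<le>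
             (norm ((H\<^sup>2) $ k) + (\<Sum>i=1..<k. norm (H $ i * H $ (k - i)))) * R ^ k"
      using R by (intro mult_right_mono) auto
    also have "\<dots> = norm ((H\<^sup>2) $ k) * R ^ k + (\<Sum>i=1..<k. norm (H $ i * H $ (k - i)) * R ^ k)"
      by (simp add: distrib_right sum_distrib_right)
    also have "(\<Sum>i=1..<k. norm (H $ i * H $ (k - i)) * R ^ k) = (\<Sum>i=1..<k. a i * a (k - i))"
    proof (rule sum.cong[OF refl])
      fix i assume "i \<in> {1..<k}"
      hence "R ^ k = R ^ i * R ^ (k - i)" by (simp flip: power_add)
      thus "norm (H $ i * H $ (k - i)) * R ^ k = a i * a (k - i)"
        by (simp add: a_def norm_mult)
    qed
    finally show ?thesis by (simp add: a_def norm_mult)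
  qed
  \<comment> \<open>The index pairs \<open>(i, k - i)\<close> are distinct and both components are at most \<open>m\<close>.\<close>
  have "(\<Sum>k=1..Suc m. \<Sum>i=1..<k. a i * a (k - i))
          = (\<Sum>(k, i)\<in>(SIGMA k:{1..Suc m}. {1..<k}). a i * a (k - i))"
    by (rule sum.Sigma) auto
  also have "\<dots> = (\<Sum>(i, j)\<in>(\<lambda>(k, i). (i, k - i)) ` (SIGMA k:{1..Suc m}. {1..<k}). a i * a j)"
    by (subst sum.reindex) (auto simp: inj_on_def case_prod_unfold)
  also have "\<dots> \<le> (\<Sum>(i, j)\<in>{1..m} \<times> {1..m}. a i * a j)"
    by (rule sum_mono2) (auto simp: a_nonneg)
  also have "\<dots> = (\<Sum>i=1..m. a i) * (\<Sum>j=1..m. a j)"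
    by (simp add: sum_product sum.cartesian_product)
  also have "\<dots> \<le> \<eta> * 1"
    using Suc.IH \<eta> \<open>\<eta> \<ge> 0\<close> by (intro mult_mono) (auto simp: a_def[symmetric] intro!: sum_nonneg a_nonneg)
  finally have conv: "(\<Sum>k=1..Suc m. \<Sum>i=1..<k. a i * a (k - i)) \<le> \<eta>" by simp
  have "2 * (\<Sum>k=1..Suc m. a k) \<le>
          (\<Sum>k=1..Suc m. norm ((H\<^sup>2) $ k) * R ^ k + (\<Sum>i=1..<k. a i * a (k - i)))"
    unfolding sum_distrib_left by (rule sum_mono) (rule coeff, simp)
  also have "\<dots> \<le> \<eta> + \<eta>"
    unfolding sum.distrib by (rule add_mono[OF tail conv])
  finally show ?case by (simp add: a_def)
qed

text \<open>
  The power series of \<open>sqrt (1 - z / \<rho>)\<close>, obtained from that of \<open>sqrt (1 - 4 * z)\<close> by rescaling.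
\<close>
definition scaled_sqrt_gf :: "complex \<Rightarrow> complex fps" where
  "scaled_sqrt_gf \<rho> = Abs_fps (\<lambda>n. of_real (sqrt_gf $ n) / (4 * \<rho>) ^ n)"

lemma scaled_sqrt_gf_square:
  assumes "\<rho> \<noteq> 0"
  shows "(scaled_sqrt_gf \<rho>)\<^sup>2 = fps_of_poly [:1, -1/\<rho>:]"
proof (rule fps_ext)
  fix n
  have "((scaled_sqrt_gf \<rho>)\<^sup>2) $ n =
          (\<Sum>i=0..n. of_real (sqrt_gf $ i * sqrt_gf $ (n - i)) / (4 * \<rho>) ^ n)"
    unfolding power2_eq_square fps_mult_nth
  proof (rule sum.cong[OF refl])
    fix i assume "i \<in> {0..n}"
    hence "(4 * \<rho>) ^ n = (4 * \<rho>) ^ i * (4 * \<rho>) ^ (n - i)"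
      by (subst power_add[symmetric]) simp
    thus "scaled_sqrt_gf \<rho> $ i * scaled_sqrt_gf \<rho> $ (n - i) =
            of_real (sqrt_gf $ i * sqrt_gf $ (n - i)) / (4 * \<rho>) ^ n"
      by (simp only: scaled_sqrt_gf_def fps_nth_Abs_fps of_real_mult times_divide_times_eq)
  qed
  also have "\<dots> = of_real ((sqrt_gf\<^sup>2) $ n) / (4 * \<rho>) ^ n"
    unfolding power2_eq_square fps_mult_nth of_real_sum sum_divide_distrib ..
  also have "\<dots> = fps_of_poly [:1, -1/\<rho>:] $ n"
    unfolding sqrt_gf_square using assms
    by (simp add: numeral_fps_const fps_X_def coeff_pCons fps_one_def split: nat.splits)
  finally show "((scaled_sqrt_gf \<rho>)\<^sup>2) $ n = fps_of_poly [:1, -1/\<rho>:] $ n" .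
qed

text \<open>
  Coefficient transfer without contour integrals. Write \<open>Y = S * H\<close> with \<open>S = sqrt (1 - z / \<rho>)\<close> and
  \<open>H\<^sup>2 = Q\<close>. In the convolution for \<open>Y\<close> the term with \<open>k = 0\<close> is the coefficient of \<open>S\<close>, and the
  \<open>k\<close>-th term is smaller by a factor of at most \<open>norm (H $ k) * norm (4 * \<rho>) ^ k\<close>, where
  \<open>norm (4 * \<rho>) \<le> 2\<close>. The tail bound for \<open>H\<close> finishes the estimate.
\<close>
lemma sqrt_coeff_transfer:
  fixes Y :: "complex fps"
  assumes Y: "Y\<^sup>2 = fps_of_poly ([:1, -1/\<rho>:] * Q)" "Y $ 0 = 1"
    and \<rho>: "\<rho> \<noteq> 0" "norm \<rho> \<le> 1/2"
    and tail: "\<And>m. (\<Sum>k=1..m. norm (coeff Q k) * 2 ^ k) \<le> \<eta>" and \<eta>: "\<eta> \<le> 1"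
  shows "norm (Y $ n * (4 * \<rho>) ^ n / sqrt_gf $ n - 1) \<le> \<eta>"
proof -
  define S where "S = scaled_sqrt_gf \<rho>"
  have S0: "S $ 0 = 1" by (simp add: S_def scaled_sqrt_gf_def)
  hence inv: "S * inverse S = 1" by (intro inverse_mult_eq_1') simp
  define H where "H = Y * inverse S"
  have "H\<^sup>2 = fps_of_poly Q * (S * inverse S)\<^sup>2"
    unfolding H_def power_mult_distrib Y(1) fps_of_poly_mult
      scaled_sqrt_gf_square[OF \<rho>(1), symmetric] S_def[symmetric]
    by (simp add: algebra_simps)
  hence H2: "H\<^sup>2 = fps_of_poly Q" unfolding inv by simp
  have H0: "H $ 0 = 1" by (simp add: H_def Y(2) S0)
  have Hsum: "(\<Sum>k=1..m. norm (H $ k) * 2 ^ k) \<le> \<eta>" for m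
    by (rule fps_sqrt_tail_bound[OF H0 _ \<eta>]) (use tail in \<open>simp_all add: H2\<close>)
  have "Y = H * S"
    using inv by (simp add: H_def mult.assoc mult.commute[of "inverse S"])
  hence "Y $ n = (\<Sum>k=0..n. H $ k * S $ (n - k))"
    by (simp add: fps_mult_nth)
  also have "{0..n} = insert 0 {1..n}" by auto
  finally have "Y $ n = S $ n + (\<Sum>k=1..n. H $ k * S $ (n - k))"
    by (simp add: H0)
  hence "Y $ n * (4 * \<rho>) ^ n / sqrt_gf $ n - 1 =
           (\<Sum>k=1..n. H $ k * S $ (n - k)) * (4 * \<rho>) ^ n / sqrt_gf $ n"
    using \<rho>(1) by (simp add: S_def scaled_sqrt_gf_def field_simps)
  also have "\<dots> = (\<Sum>k=1..n. H $ k * S $ (n - k) * (4 * \<rho>) ^ n / sqrt_gf $ n)"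
    by (simp add: sum_distrib_right sum_divide_distrib)
  also have "norm \<dots> \<le> (\<Sum>k=1..n. norm (H $ k) * 2 ^ k)"
  proof (rule sum_norm_le)
    fix k assume k: "k \<in> {1..n}"
    hence "(4 * \<rho>) ^ n = (4 * \<rho>) ^ k * (4 * \<rho>) ^ (n - k)"
      by (subst power_add[symmetric]) simp
    hence "norm (H $ k * S $ (n - k) * (4 * \<rho>) ^ n / sqrt_gf $ n) =
             norm (H $ k) * (norm (4 * \<rho>) ^ k * (\<bar>sqrt_gf $ (n - k)\<bar> / \<bar>sqrt_gf $ n\<bar>))"
      using \<rho>(1) by (simp add: S_def scaled_sqrt_gf_def norm_mult norm_divide norm_power)
    also have "\<dots> \<le> norm (H $ k) * (2 ^ k * 1)"
      using \<rho>(2) sqrt_gf_mono[of "n - k" n]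
      by (intro mult_left_mono mult_mono power_mono) (auto simp: norm_mult divide_le_eq_1)
    finally show "norm (H $ k * S $ (n - k) * (4 * \<rho>) ^ n / sqrt_gf $ n) \<le> norm (H $ k) * 2 ^ k"
      by simp
  qed
  also have "\<dots> \<le> \<eta>" by (rule Hsum)
  finally show ?thesis .
qed

lemma expectation_power_eq:
  assumes "n \<ge> 1"
  shows "measure_pmf.expectation (random_tree n) (\<lambda>t. v ^ num_nodes ((rho ^^ r) t)) =
           (1 - 2 * tree_gf (\<lambda>t. v ^ num_nodes ((rho ^^ r) t))) $ n / complex_of_real (sqrt_gf $ n)"
  using assms unfolding expectation_random_tree[OF assms] sqrt_gf_nth[OF assms]
  by (simp add: tree_gf_def numeral_fps_const scaleR_conv_of_real inverse_eq_divide)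

text \<open>
  The probability generating function of the size behaves like the \<open>n\<close>-th power of
  \<open>1 / (4 * \<rho> v)\<close>, with an error that is uniform in \<open>n\<close> and vanishes as \<open>v\<close> tends to 1.
\<close>
lemma quasi_power_expansion:
  obtains C \<rho> where "C > 0"
    "\<And>v. norm v = 1 \<Longrightarrow> C * norm (v - 1) \<le> 1/4 \<Longrightarrow> norm (\<rho> v - 1/4) \<le> C * norm (v - 1)"
    "\<And>v. norm v = 1 \<Longrightarrow> C * norm (v - 1) \<le> 1/4 \<Longrightarrow> poly (disc_poly r v) (\<rho> v) = 0"
    "\<And>v n. norm v = 1 \<Longrightarrow> C * norm (v - 1) \<le> 1/4 \<Longrightarrow> n \<ge> 1 \<Longrightarrow>
       norm (measure_pmf.expectation (random_tree n) (\<lambda>t. v ^ num_nodes ((rho ^^ r) t))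
             * (4 * \<rho> v) ^ n - 1) \<le> C * norm (v - 1)"
proof -
  obtain M where M: "M > 0"
    "\<And>v. norm v = 1 \<Longrightarrow> M * norm (v - 1) \<le> 1/4 \<Longrightarrow>
       \<exists>\<rho>. norm (\<rho> - 1/4) \<le> M * norm (v - 1) \<and> poly (disc_poly r v) \<rho> = 0"
    by (rule disc_poly_root_exists[of r]) blast
  obtain D where D: "D > 0"
    "\<And>v \<rho>. norm v = 1 \<Longrightarrow> \<rho> \<noteq> 0 \<Longrightarrow> norm \<rho> \<le> 1/2 \<Longrightarrow> poly (disc_poly r v) \<rho> = 0 \<Longrightarrow>
       \<exists>Q. disc_poly r v = [:1, -1/\<rho>:] * Q \<and>
           (\<forall>m. (\<Sum>k=1..m. norm (coeff Q k) * 2 ^ k) \<le> D * norm (v - 1))"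
    by (rule disc_poly_factor[of r]) blast
  define C where "C = M + D"
  have le: "M * norm (v - 1) \<le> C * norm (v - 1)" "D * norm (v - 1) \<le> C * norm (v - 1)" for v :: complex
    using M(1) D(1) by (auto simp: C_def intro!: mult_right_mono)
  have "\<exists>\<rho>. norm v = 1 \<longrightarrow> C * norm (v - 1) \<le> 1/4 \<longrightarrow>
      norm (\<rho> - 1/4) \<le> M * norm (v - 1) \<and> poly (disc_poly r v) \<rho> = 0" for v
    using M(2)[of v] order.trans[OF le(1)[of v]] by blast
  then obtain \<rho> where \<rho>: "\<And>v. norm v = 1 \<Longrightarrow> C * norm (v - 1) \<le> 1/4 \<Longrightarrow>
      norm (\<rho> v - 1/4) \<le> M * norm (v - 1) \<and> poly (disc_poly r v) (\<rho> v) = 0"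
    by metis
  show ?thesis
  proof (rule that[of C \<rho>])
    fix v :: complex and n :: nat
    assume v: "norm v = 1" "C * norm (v - 1) \<le> 1/4" and n: "n \<ge> 1"
    have close: "norm (\<rho> v - 1/4) \<le> 1/4"
      using \<rho>[OF v] le(1)[of v] v(2) by linarith
    have root: "poly (disc_poly r v) (\<rho> v) = 0" using \<rho>[OF v] by simp
    \<comment> \<open>The constant coefficient of the discriminant is 1.\<close>
    have nz: "\<rho> v \<noteq> 0"
      using root by (auto simp: disc_poly_def poly_short_poly_0)
    have small: "norm (\<rho> v) \<le> 1/2"
      using norm_triangle_ineq[of "\<rho> v - 1/4" "1/4"] close by (simp add: norm_divide)
    obtain Q where Q: "disc_poly r v = [:1, -1/\<rho> v:] * Q"
      "\<And>m. (\<Sum>k=1..m. norm (coeff Q k) * 2 ^ k) \<le> D * norm (v - 1)"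
      using D(2)[OF v(1) nz small root] by blast
    define Y where "Y = 1 - 2 * tree_gf (\<lambda>t. v ^ num_nodes ((rho ^^ r) t))"
    have "Y $ 0 = 1"
      by (simp add: Y_def tree_gf_def plane_trees_0 numeral_fps_const)
    moreover have "Y\<^sup>2 = fps_of_poly ([:1, -1/\<rho> v:] * Q)"
      unfolding Y_def size_gf_disc Q(1) ..
    ultimately have "norm (Y $ n * (4 * \<rho> v) ^ n / sqrt_gf $ n - 1) \<le> D * norm (v - 1)"
      using nz small Q(2) le(2)[of v] v(2) by (intro sqrt_coeff_transfer) auto
    thus "norm (measure_pmf.expectation (random_tree n) (\<lambda>t. v ^ num_nodes ((rho ^^ r) t))
             * (4 * \<rho> v) ^ n - 1) \<le> C * norm (v - 1)"
      using le(2)[of v] unfolding expectation_power_eq[OF n] Y_def[symmetric] by simp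
  next
    show "norm (\<rho> v - 1/4) \<le> C * norm (v - 1)" if "norm v = 1" "C * norm (v - 1) \<le> 1/4" for v
      using \<rho>[OF that] le(1)[of v] by linarith
    show "poly (disc_poly r v) (\<rho> v) = 0" if "norm v = 1" "C * norm (v - 1) \<le> 1/4" for v
      using \<rho>[OF that] by simp
  qed (use M(1) D(1) in \<open>simp add: C_def\<close>)
qed

section \<open>The central limit theorem\<close>

lemma tendsto_one_plus_over_n_power:
  fixes w :: "nat \<Rightarrow> complex"
  assumes w: "w \<longlonglongrightarrow> l"
  shows "(\<lambda>n. (1 + w n / of_nat n) ^ n) \<longlonglongrightarrow> exp l"
proof -
  define x where "x n = w n / of_nat n" for n
  have x: "x \<longlonglongrightarrow> 0"
    unfolding x_def using tendsto_mult[OF w lim_inverse_n] by (simp add: divide_inverse)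
  have small: "eventually (\<lambda>n. norm (x n) < 1/2) sequentially"
    using tendsto_norm_zero[OF x] by (rule order_tendstoD) simp
  have "(\<lambda>n. of_nat n * (Ln (1 + x n) - x n)) \<longlonglongrightarrow> 0"
  proof (rule Lim_null_comparison)
    show "eventually (\<lambda>n. norm (of_nat n * (Ln (1 + x n) - x n)) \<le> 2 * norm (w n) * norm (x n)) sequentially"
      using small eventually_gt_at_top[of 0]
    proof eventually_elim
      case (elim n)
      have "norm (Ln (1 + x n) - x n) \<le> norm (x n) ^ 2 / (1 - norm (x n))"
        using elim by (intro Ln_approx_linear) simp
      also have "\<dots> \<le> norm (x n) ^ 2 / (1/2)"
        using elim by (intro divide_left_mono) auto
      finally have "real n * norm (Ln (1 + x n) - x n) \<le> real n * (norm (x n) ^ 2 / (1/2))"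
        by (intro mult_left_mono) auto
      also have "\<dots> = 2 * (real n * norm (x n)) * norm (x n)"
        by (simp add: power2_eq_square)
      also have "real n * norm (x n) = norm (w n)"
        using elim by (simp add: x_def norm_divide)
      finally show ?case by (simp add: norm_mult)
    qed
    show "(\<lambda>n. 2 * norm (w n) * norm (x n)) \<longlonglongrightarrow> 0"
      using tendsto_mult[OF tendsto_mult[OF tendsto_const tendsto_norm[OF w]] tendsto_norm[OF x]] by simp
  qed
  hence "(\<lambda>n. of_nat n * (Ln (1 + x n) - x n) + w n) \<longlonglongrightarrow> 0 + l"
    by (intro tendsto_add w)
  hence "(\<lambda>n. exp (of_nat n * (Ln (1 + x n) - x n) + w n)) \<longlonglongrightarrow> exp l"
    by (intro tendsto_exp) simp
  moreover have "eventually (\<lambda>n. exp (of_nat n * (Ln (1 + x n) - x n) + w n) = (1 + x n) ^ n) sequentially"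
    using small eventually_gt_at_top[of 0]
  proof eventually_elim
    case (elim n)
    have "1 + x n \<noteq> 0"
    proof
      assume "1 + x n = 0"
      hence "x n = -1" by (simp add: add_eq_0_iff)
      thus False using elim by simp
    qed
    moreover have "of_nat n * (Ln (1 + x n) - x n) + w n = of_nat n * Ln (1 + x n)"
      using elim by (simp add: x_def algebra_simps)
    ultimately show ?case by (simp add: exp_of_nat_mult)
  qed
  ultimately show ?thesis
    unfolding x_def[symmetric] by (rule Lim_transform_eventually)
qed

text \<open>
  For the limit of an \<open>n\<close>-th power, \<open>cis\<close> is needed up to second order where it enters linearly, and
  up to first order where it is squared or comes with another factor of order \<open>1 / sqrt n\<close>.
\<close>
lemma cis_expand_sqrt:
  fixes k :: real
  shows "(\<lambda>n. of_nat n * (cis (k / sqrt (real n)) - 1 - \<i> * of_real (k / sqrt (real n)))) \<longlonglongrightarrow> of_real (- (k\<^sup>2) / 2)"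
    and "(\<lambda>n. of_real (sqrt (real n)) * (cis (k / sqrt (real n)) - 1)) \<longlonglongrightarrow> \<i> * of_real k"
proof -
  have re: "(\<lambda>n. real n * (cos (k / sqrt (real n)) - 1)) \<longlonglongrightarrow> - (k\<^sup>2) / 2"
   and im: "(\<lambda>n. real n * (sin (k / sqrt (real n)) - k / sqrt (real n))) \<longlonglongrightarrow> 0"
   and re': "(\<lambda>n. sqrt (real n) * (cos (k / sqrt (real n)) - 1)) \<longlonglongrightarrow> 0"
   and im': "(\<lambda>n. sqrt (real n) * sin (k / sqrt (real n))) \<longlonglongrightarrow> k"
    \<comment> \<open>The sign of \<open>k\<close> has to be known for the asymptotic expansions.\<close>
    by (cases k "0 :: real" rule: linorder_cases; real_asymp simp: power2_eq_square)+
  show "(\<lambda>n. of_nat n * (cis (k / sqrt (real n)) - 1 - \<i> * of_real (k / sqrt (real n)))) \<longlonglongrightarrow> of_real (- (k\<^sup>2) / 2)"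
    using re im by (simp add: tendsto_complex_iff)
  show "(\<lambda>n. of_real (sqrt (real n)) * (cis (k / sqrt (real n)) - 1)) \<longlonglongrightarrow> \<i> * of_real k"
    using re' im' by (simp add: tendsto_complex_iff)
qed

text \<open>
  Second order expansion of the root in \<open>v - 1\<close>. The fixed point equation
  \<open>\<rho> - 1/4 = (v - 1) * x\<close> is inserted into itself once, with the Taylor quotient of
  \<open>short_poly r\<close> at \<open>1/4\<close> expressing the dependence of \<open>x\<close> on \<open>\<rho>\<close>. The remaining factor \<open>y\<close>
  is a polynomial in \<open>v\<close> and \<open>\<rho>\<close>, so its limit is its value at \<open>(1, 1/4)\<close>. No division by \<open>v - 1\<close>
  is involved, so \<open>v = 1\<close> is not exceptional.
\<close>
lemma disc_poly_root_expand:
  obtains y where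
    "\<And>v \<rho>. poly (disc_poly r v) \<rho> = 0 \<Longrightarrow>
       4 * \<rho> = 1 - of_real (mu r) * (v - 1) + 4 * (v - 1)\<^sup>2 * y v \<rho>"
    "\<And>v \<rho>. \<rho> \<longlonglongrightarrow> 1/4 \<Longrightarrow> v \<longlonglongrightarrow> 1 \<Longrightarrow>
       (\<lambda>n. y (v n) (\<rho> n)) \<longlonglongrightarrow> of_real (((mu r)\<^sup>2 + mu r - sigma_sq r) / 8)"
proof -
  define a :: "complex poly" where "a = short_poly r"
  define b d where "b = poly (B_poly r) (1/4)" and "d = poly (pderiv (B_poly r)) (1/4)"
  have a_quarter: "poly a (1/4) = of_real (b / 4)"
    using poly_short_poly_complex[of r "1/4"] by (simp add: a_def short_poly_real b_def)
  have a'_quarter: "poly (pderiv a) (1/4) = of_real (b + d / 4)"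
    using poly_pderiv_short_poly_complex[of r "1/4"]
    by (simp add: a_def short_poly_real b_def d_def pderiv_mult pderiv_pCons)
  obtain k where k: "a - [:0, 2:] = [:poly (a - [:0, 2:]) (1/4):] + [:-(1/4), 1:] * k"
    "poly k (1/4) = poly (pderiv (a - [:0, 2:])) (1/4)"
    by (rule poly_expand_at)
  have k': "poly a z = 2 * z - of_real (mu r) / 4 + (z - 1/4) * poly k z" for z
    using arg_cong[OF k(1), of "\<lambda>p. poly p z"]
    by (simp add: a_quarter mu_def b_def[symmetric] algebra_simps diff_divide_distrib)
  have k_quarter: "poly k (1/4) = of_real (b + d / 4 - 2)"
    by (simp add: k(2) pderiv_diff a'_quarter pderiv_pCons)
  \<comment> \<open>By the fixed point equation, \<open>x\<close> and \<open>y\<close> are the first and second order difference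
      quotients of the root with respect to \<open>v\<close>.\<close>
  define x where "x v z = poly a z - 2 * z + (v - 1) * (poly a z - z)" for v z
  define y where "y v z = x v z * poly k z + poly a z - z" for v z
  show ?thesis
  proof (rule that[of y])
    fix v \<rho> assume root: "poly (disc_poly r v) \<rho> = 0"
    have "poly (disc_poly r v) \<rho> = 4 * ((v - 1) * x v \<rho> - (\<rho> - 1/4))"
      by (simp add: disc_poly_def x_def a_def algebra_simps)
    hence "(v - 1) * x v \<rho> - (\<rho> - 1/4) = 0"
      unfolding root by (metis mult_eq_0_iff zero_neq_numeral)
    hence fix1: "\<rho> - 1/4 = (v - 1) * x v \<rho>"
      by (simp only: right_minus_eq)
    have "x v \<rho> = - of_real (mu r) / 4 + (\<rho> - 1/4) * poly k \<rho> + (v - 1) * (poly a \<rho> - \<rho>)"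
      by (simp add: x_def k' algebra_simps)
    also have "\<dots> = - of_real (mu r) / 4 + (v - 1) * y v \<rho>"
      unfolding fix1 y_def by (simp add: algebra_simps)
    finally have "\<rho> - 1/4 = (v - 1) * (- of_real (mu r) / 4 + (v - 1) * y v \<rho>)"
      using fix1 by simp
    hence "4 * (\<rho> - 1/4) = 4 * ((v - 1) * (- of_real (mu r) / 4 + (v - 1) * y v \<rho>))"
      by (simp only:)
    also have "\<dots> = - of_real (mu r) * (v - 1) + 4 * (v - 1)\<^sup>2 * y v \<rho>"
      by (simp add: algebra_simps power2_eq_square diff_divide_distrib)
    finally show "4 * \<rho> = 1 - of_real (mu r) * (v - 1) + 4 * (v - 1)\<^sup>2 * y v \<rho>"
      by (simp add: algebra_simps)
  next
    fix v \<rho> :: "nat \<Rightarrow> complex"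
    assume \<rho>: "\<rho> \<longlonglongrightarrow> 1/4" and v: "v \<longlonglongrightarrow> 1"
    have "(\<lambda>n. y (v n) (\<rho> n)) \<longlonglongrightarrow> y 1 (1/4)"
      unfolding y_def x_def by (intro tendsto_intros \<rho> v isCont_tendsto_compose[OF poly_isCont])
    also have "y 1 (1/4) = of_real (((mu r)\<^sup>2 + mu r - sigma_sq r) / 8)"
      by (simp add: y_def x_def a_quarter k_quarter mu_def sigma_sq_def b_def[symmetric] d_def[symmetric]
           field_simps power2_eq_square)
    finally show "(\<lambda>n. y (v n) (\<rho> n)) \<longlonglongrightarrow> of_real (((mu r)\<^sup>2 + mu r - sigma_sq r) / 8)" .
  qed
qed

lemma char_reduced_size:
  assumes v: "v = cis (t / sqrt (sigma_sq r * real n))"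
  shows "char (distr (measure_pmf (random_tree n)) borel
              (\<lambda>u. (reduced_size r u - mu r * real n) / sqrt (sigma_sq r * real n))) t
         = measure_pmf.expectation (random_tree n) (\<lambda>u. v ^ num_nodes ((rho ^^ r) u))
           * cis (- (mu r * (t / sqrt (sigma_sq r * real n)))) ^ n"
proof -
  have *: "iexp (t * ((reduced_size r u - mu r * real n) / sqrt (sigma_sq r * real n))) =
        v ^ num_nodes ((rho ^^ r) u) * cis (- (mu r * (t / sqrt (sigma_sq r * real n)))) ^ n" for u
  proof -
    have "t * ((reduced_size r u - mu r * real n) / sqrt (sigma_sq r * real n)) =
            real (num_nodes ((rho ^^ r) u)) * (t / sqrt (sigma_sq r * real n))
            + real n * - (mu r * (t / sqrt (sigma_sq r * real n)))"
      by (simp add: reduced_size_def diff_divide_distrib right_diff_distrib mult_ac)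
    hence "iexp (t * ((reduced_size r u - mu r * real n) / sqrt (sigma_sq r * real n))) =
        cis (real (num_nodes ((rho ^^ r) u)) * (t / sqrt (sigma_sq r * real n)))
        * cis (real n * - (mu r * (t / sqrt (sigma_sq r * real n))))"
      unfolding cis_mult by (simp only: cis_conv_exp)
    thus ?thesis
      by (simp only: v Complex.DeMoivre)
  qed
  have "char (distr (measure_pmf (random_tree n)) borel
              (\<lambda>u. (reduced_size r u - mu r * real n) / sqrt (sigma_sq r * real n))) t
        = measure_pmf.expectation (random_tree n)
            (\<lambda>u. iexp (t * ((reduced_size r u - mu r * real n) / sqrt (sigma_sq r * real n))))"
    unfolding char_def by (rule integral_distr) simp_all
  thus ?thesis
    unfolding * by simp
qed

text \<open>
  With \<open>v = cis (k / sqrt n)\<close>, the characteristic function is asymptotically the inverse of the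
  \<open>n\<close>-th power of \<open>4 * \<rho> v * cis (mu r * k / sqrt n)\<close>. In the product of the two expansions the
  terms of order \<open>1 / sqrt n\<close> cancel, and those of order \<open>1 / n\<close> add up to \<open>sigma_sq r * k\<^sup>2 / 2\<close>, which
  is \<open>t\<^sup>2 / 2\<close> for \<open>k = t / sqrt (sigma_sq r)\<close>.
\<close>
lemma reduced_size_clt:
  assumes "r \<ge> 1"
  shows "weak_conv_m
           (\<lambda>n. distr (measure_pmf (random_tree n)) borel
              (\<lambda>t. (reduced_size r t - mu r * real n) / sqrt (sigma_sq r * real n)))
           std_normal_distribution"
proof (rule levy_continuity)
  show "real_distribution (distr (measure_pmf (random_tree n)) borel
              (\<lambda>t. (reduced_size r t - mu r * real n) / sqrt (sigma_sq r * real n)))" for n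
    by (rule prob_space.real_distribution_distr[OF measure_pmf.prob_space_axioms]) simp
  show "real_distribution std_normal_distribution"
    by (rule real_dist_normal_dist)
next
  fix t :: real
  define \<mu> \<sigma> k where "\<mu> = mu r" and "\<sigma> = sqrt (sigma_sq r)" and "k = t / \<sigma>"
  have \<sigma>: "\<sigma> > 0" "\<sigma>\<^sup>2 = sigma_sq r"
    using sigma_sq_pos[OF assms] by (simp_all add: \<sigma>_def)
  define v where "v n = cis (k / sqrt (real n))" for n
  have v_eq: "cis (t / sqrt (sigma_sq r * real n)) = v n" for n
    by (simp add: v_def k_def \<sigma>_def real_sqrt_mult)
  obtain C root where C: "C > 0"
    "\<And>v. norm v = 1 \<Longrightarrow> C * norm (v - 1) \<le> 1/4 \<Longrightarrow> norm (root v - 1/4) \<le> C * norm (v - 1)"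
    "\<And>v. norm v = 1 \<Longrightarrow> C * norm (v - 1) \<le> 1/4 \<Longrightarrow> poly (disc_poly r v) (root v) = 0"
    "\<And>v n. norm v = 1 \<Longrightarrow> C * norm (v - 1) \<le> 1/4 \<Longrightarrow> n \<ge> 1 \<Longrightarrow>
       norm (measure_pmf.expectation (random_tree n) (\<lambda>t. v ^ num_nodes ((rho ^^ r) t))
             * (4 * root v) ^ n - 1) \<le> C * norm (v - 1)"
    by (rule quasi_power_expansion[of r]) blast
  obtain y where y: "\<And>v \<rho>. poly (disc_poly r v) \<rho> = 0 \<Longrightarrow>
       4 * \<rho> = 1 - of_real \<mu> * (v - 1) + 4 * (v - 1)\<^sup>2 * y v \<rho>"
    "\<And>v \<rho>. \<rho> \<longlonglongrightarrow> 1/4 \<Longrightarrow> v \<longlonglongrightarrow> 1 \<Longrightarrow>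
       (\<lambda>n. y (v n) (\<rho> n)) \<longlonglongrightarrow> of_real ((\<mu>\<^sup>2 + \<mu> - sigma_sq r) / 8)"
    unfolding \<mu>_def by (rule disc_poly_root_expand[of r]) blast
  define \<rho> where "\<rho> n = root (v n)" for n
  define E where "E n = cis (\<mu> * k / sqrt (real n))" for n
  define G where "G n = measure_pmf.expectation (random_tree n) (\<lambda>u. v n ^ num_nodes ((rho ^^ r) u))" for n
  have norm_v: "norm (v n) = 1" for n by (simp add: v_def)
  have lim0: "(\<lambda>n. c / sqrt (real n)) \<longlonglongrightarrow> 0" for c
    by (cases c "0 :: real" rule: linorder_cases; real_asymp)
  have v: "v \<longlonglongrightarrow> 1" and E: "E \<longlonglongrightarrow> 1"
    using tendsto_cos[OF lim0] tendsto_sin[OF lim0]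
    by (simp_all add: v_def E_def tendsto_complex_iff)
  have err: "(\<lambda>n. C * norm (v n - 1)) \<longlonglongrightarrow> 0"
    using tendsto_mult_right_zero[OF tendsto_norm_zero[OF LIM_zero[OF v]]] .
  have close: "eventually (\<lambda>n. C * norm (v n - 1) \<le> 1/4) sequentially"
    using order_tendstoD(2)[OF err, of "1/4"] by (auto elim: eventually_mono)
  have \<rho>: "\<rho> \<longlonglongrightarrow> 1/4"
  proof (rule LIM_zero_cancel, rule Lim_null_comparison[OF _ err])
    show "eventually (\<lambda>n. norm (\<rho> n - 1/4) \<le> C * norm (v n - 1)) sequentially"
      using close by eventually_elim (auto simp: \<rho>_def intro: C(2) norm_v)
  qed
  have G: "(\<lambda>n. G n * (4 * \<rho> n) ^ n) \<longlonglongrightarrow> 1"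
  proof (rule LIM_zero_cancel, rule Lim_null_comparison[OF _ err])
    show "eventually (\<lambda>n. norm (G n * (4 * \<rho> n) ^ n - 1) \<le> C * norm (v n - 1)) sequentially"
      using close eventually_ge_at_top[of 1]
    proof eventually_elim
      case (elim n)
      show ?case unfolding \<rho>_def G_def by (rule C(4)[OF norm_v elim])
    qed
  qed
  define w where "w n = of_nat n * (4 * \<rho> n * E n - 1)" for n
  have w: "w \<longlonglongrightarrow> of_real (t\<^sup>2 / 2)"
  proof -
    define P where "P c n = of_nat n * (cis (c / sqrt (real n)) - 1 - \<i> * of_real (c / sqrt (real n)))"
      for c :: real and n
    define Q where "Q c n = of_real (sqrt (real n)) * (cis (c / sqrt (real n)) - 1)"
      for c :: real and n
    define Y where "Y n = y (v n) (\<rho> n)" for n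
    have lim_P: "P c \<longlonglongrightarrow> of_real (- (c\<^sup>2) / 2)" and lim_Q: "Q c \<longlonglongrightarrow> \<i> * of_real c" for c
      unfolding P_def Q_def by (rule cis_expand_sqrt)+
    have lim_Y: "Y \<longlonglongrightarrow> of_real ((\<mu>\<^sup>2 + \<mu> - sigma_sq r) / 8)"
      unfolding Y_def by (rule y(2)[OF \<rho> v])
    \<comment> \<open>In \<open>w n\<close> the contributions \<open>\<i> * \<mu> * k * sqrt n\<close> of \<open>E n\<close> and \<open>- \<i> * \<mu> * k * sqrt n * E n\<close> of the
        root diverge, but their sum is a multiple of \<open>Q (\<mu> * k) n\<close>, which converges.\<close>
    have "(\<lambda>n. P (\<mu> * k) n - of_real \<mu> * P k n * E n - \<i> * of_real (\<mu> * k) * Q (\<mu> * k) n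
             + 4 * (Q k n)\<^sup>2 * Y n * E n) \<longlonglongrightarrow>
          of_real (- ((\<mu> * k)\<^sup>2) / 2) - of_real \<mu> * of_real (- (k\<^sup>2) / 2) * 1
            - \<i> * of_real (\<mu> * k) * (\<i> * of_real (\<mu> * k))
            + 4 * (\<i> * of_real k)\<^sup>2 * of_real ((\<mu>\<^sup>2 + \<mu> - sigma_sq r) / 8) * 1"
      by (intro tendsto_intros lim_P lim_Q lim_Y E)
    also have "of_real (- ((\<mu> * k)\<^sup>2) / 2) - of_real \<mu> * of_real (- (k\<^sup>2) / 2) * 1
            - \<i> * of_real (\<mu> * k) * (\<i> * of_real (\<mu> * k))
            + 4 * (\<i> * of_real k)\<^sup>2 * of_real ((\<mu>\<^sup>2 + \<mu> - sigma_sq r) / 8) * 1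
          = complex_of_real (sigma_sq r * k\<^sup>2 / 2)"
      by (simp add: complex_eq_iff power2_eq_square field_simps)
    also have "sigma_sq r * k\<^sup>2 / 2 = t\<^sup>2 / 2"
      using \<sigma>(2) sigma_sq_pos[OF assms] by (simp add: k_def power_divide)
    finally have lim: "(\<lambda>n. P (\<mu> * k) n - of_real \<mu> * P k n * E n - \<i> * of_real (\<mu> * k) * Q (\<mu> * k) n
             + 4 * (Q k n)\<^sup>2 * Y n * E n) \<longlonglongrightarrow> of_real (t\<^sup>2 / 2)" .
    have "eventually (\<lambda>n. P (\<mu> * k) n - of_real \<mu> * P k n * E n - \<i> * of_real (\<mu> * k) * Q (\<mu> * k) n
             + 4 * (Q k n)\<^sup>2 * Y n * E n = w n) sequentially"
      using close eventually_gt_at_top[of 0]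
    proof eventually_elim
      case (elim n)
      define s :: complex where "s = of_real (sqrt (real n))"
      have s: "of_nat n = s * s" "s \<noteq> 0"
        using elim(2) by (simp_all add: s_def flip: of_real_mult)
      have expand: "4 * \<rho> n = 1 - of_real \<mu> * (v n - 1) + 4 * (v n - 1)\<^sup>2 * Y n"
        unfolding Y_def \<rho>_def by (rule y(1)[OF C(3)[OF norm_v elim(1)]])
      have PQ: "P k n = s * s * (v n - 1) - \<i> * of_real k * s"
        "P (\<mu> * k) n = s * s * (E n - 1) - \<i> * of_real (\<mu> * k) * s"
        "Q k n = s * (v n - 1)" "Q (\<mu> * k) n = s * (E n - 1)"
        using s(2) unfolding P_def Q_def v_def E_def s(1)
        by (simp_all add: s_def[symmetric] algebra_simps)
      show ?case
        unfolding PQ w_def expand s(1) by (simp add: algebra_simps power2_eq_square)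
    qed
    with lim show ?thesis by (rule Lim_transform_eventually)
  qed
  have "(\<lambda>n. (4 * \<rho> n * E n) ^ n) \<longlonglongrightarrow> exp (of_real (t\<^sup>2 / 2))"
  proof (rule Lim_transform_eventually[OF tendsto_one_plus_over_n_power[OF w]])
    show "eventually (\<lambda>n. (1 + w n / of_nat n) ^ n = (4 * \<rho> n * E n) ^ n) sequentially"
      using eventually_gt_at_top[of 0] by eventually_elim (simp add: w_def)
  qed
  from tendsto_divide[OF G this]
  have lim: "(\<lambda>n. G n * (4 * \<rho> n) ^ n / (4 * \<rho> n * E n) ^ n) \<longlonglongrightarrow> 1 / exp (of_real (t\<^sup>2 / 2))"
    by simp
  have nz: "eventually (\<lambda>n. \<rho> n \<noteq> 0) sequentially"
    using tendsto_imp_eventually_ne[OF \<rho>, of 0] by simp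
  have "eventually (\<lambda>n. G n * (4 * \<rho> n) ^ n / (4 * \<rho> n * E n) ^ n =
      char (distr (measure_pmf (random_tree n)) borel
              (\<lambda>t. (reduced_size r t - mu r * real n) / sqrt (sigma_sq r * real n))) t) sequentially"
    using nz
  proof eventually_elim
    case (elim n)
    have E_inv: "cis (- (mu r * (t / sqrt (sigma_sq r * real n)))) = inverse (E n)"
      by (simp add: E_def \<mu>_def k_def \<sigma>_def real_sqrt_mult)
    have "G n * (4 * \<rho> n) ^ n / (4 * \<rho> n * E n) ^ n = G n / E n ^ n"
      unfolding power_mult_distrib[of "4 * \<rho> n"] using elim by simp
    also have "\<dots> = G n * inverse (E n) ^ n"
      by (simp only: divide_inverse power_inverse)
    finally show ?case
      unfolding char_reduced_size[OF v_eq[symmetric]] G_def[symmetric] E_inv .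
  qed
  with lim have "(\<lambda>n. char (distr (measure_pmf (random_tree n)) borel
              (\<lambda>t. (reduced_size r t - mu r * real n) / sqrt (sigma_sq r * real n))) t)
      \<longlonglongrightarrow> 1 / exp (of_real (t\<^sup>2 / 2))"
    by (rule Lim_transform_eventually)
  also have "1 / exp (of_real (t\<^sup>2 / 2)) = char std_normal_distribution t"
    by (simp only: char_std_normal_distribution exp_of_real exp_minus of_real_inverse
          inverse_eq_divide of_real_divide[of 1 "exp (t\<^sup>2 / 2)"] of_real_1 flip: minus_divide_left)
  finally show "(\<lambda>n. char (distr (measure_pmf (random_tree n)) borel
              (\<lambda>t. (reduced_size r t - mu r * real n) / sqrt (sigma_sq r * real n))) t)
      \<longlonglongrightarrow> char std_normal_distribution t" .
qed

theorem theorem5: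
  fixes r :: nat
  shows "((\<lambda>n::nat. measure_pmf.expectation (random_tree n) (reduced_size r)
            - (mu r * real n - poly (pderiv (B_poly r)) (1/4) / 8)) \<in> O(\<lambda>n. 1 / real n))
    \<and> ((\<lambda>n::nat. measure_pmf.variance (random_tree n) (reduced_size r)
            - sigma_sq r * real n) \<in> O(\<lambda>n. 1))
    \<and> (r \<ge> 1 \<longrightarrow>
         weak_conv_m
           (\<lambda>n::nat. distr (measure_pmf (random_tree n)) borel
              (\<lambda>t. (reduced_size r t - mu r * real n) / sqrt (sigma_sq r * real n)))
           std_normal_distribution)"
  using expectation_asymp variance_asymp reduced_size_clt by blast

end
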